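(* Let $T\in\mathbb{P}(\mathrm{Sym}^7(\mathbb{C}^3))$ be a ternary form of degree $7$ (a septic in $3$ variables), and let $A=\{P_1,\dots,P_{11}\}\subset\mathbb{P}^2$ be a minimal decomposition of $T$ consisting of $11$ (distinct) points. Assume that (1) the Kruskal's rank of $A$ is $k_1(A)=3$, i.e. no three points of $A$ are aligned; (2) the Kruskal's rank of $v_3(A)$ is $k_3(A)=10$, i.e. no $10$ points of $A$ are contained in a plane cubic or, equivalently, for every subset $A'\subset A$ with $\ell(A')\le 10$ the set $v_3(A')$ is linearly independent. Then $T$ has rank $11$ and it is identifiable (so $A$ is the unique decomposition of $T$ of length $11$).
   Context: We work over $\mathbb{C}$. For a finite set $A\subset\mathbb{P}^n=\mathbb{P}(\mathbb{C}^{n+1})$, $\ell(A)$ denotes its cardinality. $v_d:\mathbb{P}^n\to\mathbb{P}^N$, $N=\binom{n+d}{d}-1$, is the Veronese embedding of degree $d$, and $\mathbb{P}^N$ is identified with $\mathbb{P}(\mathrm{Sym}^d(\mathbb{C}^{n+1}))$, so that points of $\mathbb{P}^N$ are (nonzero) forms of degree $d$ in $n+1$ variables up to scalar; identifying points of $\mathbb{P}^n$ with linear forms $L$ up to scalar, $v_d$ sends $L$ to $L^d$. The same symbol $T$ denotes a form and the corresponding point. A finite set $A\subset\mathbb{P}^n$ is a decomposition of $T\in\mathbb{P}(\mathrm{Sym}^d(\mathbb{C}^{n+1}))$ if $T\in\langle v_d(A)\rangle$, the linear span of the points of $v_d(A)$; $\ell(A)$ is the length of the decomposition. The decomposition $A$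 is minimal (non-redundant) if $T\notin\langle v_d(A')\rangle$ for every proper subset $A'\subset A$. The (Waring) rank of $T$ is the minimum length of a decomposition of $T$. $T$ is identifiable if there is exactly one decomposition (as a finite subset of $\mathbb{P}^n$) of $T$ whose length equals the rank of $T$. A finite set of points in projective space is linearly independent if representative vectors are linearly independent. The Kruskal's rank of a finite set of points in a projective space is the maximum $k$ such that every subset of cardinality $\le k$ is linearly independent. The $d$-th Kruskal's rank $k_d(A)$ of a finite set $A\subset\mathbb{P}^n$ is the Kruskal's rank of $v_d(A)$; $k_1(A)$ is the Kruskal's rank of $A$. *)

theory Defs
  imports "HOL-Analysis.Analysis" "HOL-Library.Poly_Mapping" "HOL-Library.Numeral_Type"
begin

context vector_space
begin

text \<open>A point of a projective space is a line through the origin, represented by the set of its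
  vectors; \<open>proj_space V\<close> is \<open>\<bbbP>(V)\<close> for a linear subspace \<open>V\<close>.\<close>

definition proj_space :: "'b set \<Rightarrow> 'b set set" where
  "proj_space V = {span {v} | v. v \<in> V \<and> v \<noteq> 0}"

definition proj_span :: "'b set set \<Rightarrow> 'b set set" where
  "proj_span B = local.proj_space (span (\<Union>B))"

text \<open>Independence of \<open>r ` B\<close> forces the representatives \<open>r p\<close> to be nonzero, and
  \<open>p = span {r p}\<close> makes \<open>r\<close> injective on \<open>B\<close>; the choice of representatives is immaterial.\<close>

definition proj_independent :: "'b set set \<Rightarrow> bool" where
  "proj_independent B \<longleftrightarrow> (\<exists>r. (\<forall>p\<in>B. p = span {r p}) \<and> independent (r ` B))"

text \<open>Meant for finite \<open>B\<close>. The bound \<open>k \<le> card B\<close> makes the maximum exist when \<open>B\<close> itself is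
  independent, in which case the Kruskal rank is \<open>card B\<close>.\<close>

definition kruskal_rank :: "'b set set \<Rightarrow> nat" where
  "kruskal_rank B =
     Max {k. k \<le> card B \<and> (\<forall>B'. B' \<subseteq> B \<and> card B' \<le> k \<longrightarrow> local.proj_independent B')}"

end

text \<open>Polynomials with complex coefficients in variables indexed by \<open>'n\<close>: finitely supported
  functions from exponent vectors to coefficients, with the convolution product.\<close>

type_synonym 'n cpoly = "('n \<Rightarrow>\<^sub>0 nat) \<Rightarrow>\<^sub>0 complex"

definition cpoly_scale :: "complex \<Rightarrow> 'n cpoly \<Rightarrow> 'n cpoly" where
  "cpoly_scale c p = Poly_Mapping.single 0 c * p"

global_interpretation cpoly: vector_space "cpoly_scale :: complex \<Rightarrow> 'n cpoly \<Rightarrow> 'n cpoly"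
  by unfold_locales
    (simp_all add: cpoly_scale_def algebra_simps single_add mult_single flip: mult.assoc)

definition forms :: "nat \<Rightarrow> 'n::finite cpoly set" where
  "forms d = {p. \<forall>m \<in> Poly_Mapping.keys p. (\<Sum>i\<in>UNIV. Poly_Mapping.lookup m i) = d}"

definition linear_form :: "complex ^ 'n \<Rightarrow> 'n::finite cpoly" where
  "linear_form a = (\<Sum>i\<in>UNIV. Poly_Mapping.single (Poly_Mapping.single i 1) (a $ i))"

text \<open>Points of \<open>\<bbbP>\<^sup>n\<close> are the elements of \<open>vec.proj_space UNIV\<close> over \<open>complex ^ 'n\<close> with
  \<open>CARD('n) = n + 1\<close>. The Veronese map sends the line of \<open>a\<close> to the line of \<open>(linear_form a) ^ d\<close>;
  spanning by the powers of all representatives avoids a choice, see \<open>veronese_point\<close>.\<close>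

definition veronese :: "nat \<Rightarrow> (complex ^ 'n) set \<Rightarrow> 'n::finite cpoly set" where
  "veronese d P = cpoly.span ((\<lambda>a. linear_form a ^ d) ` P)"

lemma linear_form_scale: "linear_form (c *s a) = cpoly_scale c (linear_form a)"
  by (simp add: linear_form_def cpoly_scale_def sum_distrib_left mult_single)

lemma cpoly_scale_power: "cpoly_scale c p ^ d = cpoly_scale (c ^ d) (p ^ d)"
proof -
  have "Poly_Mapping.single 0 c ^ d = (Poly_Mapping.single 0 (c ^ d) :: 'a cpoly)"
    by (induction d) (simp_all add: mult_single)
  then show ?thesis
    by (simp add: cpoly_scale_def power_mult_distrib)
qed

lemma veronese_point: "veronese d (vec.span {a}) = cpoly.span {linear_form a ^ d}"
proof (rule antisym)
  show "veronese d (vec.span {a}) \<subseteq> cpoly.span {linear_form a ^ d}"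
    unfolding veronese_def
  proof (rule cpoly.span_minimal)
    show "(\<lambda>a. linear_form a ^ d) ` vec.span {a} \<subseteq> cpoly.span {linear_form a ^ d}"
      by (auto simp: vec.span_singleton linear_form_scale cpoly_scale_power cpoly.span_singleton)
  qed simp
  show "cpoly.span {linear_form a ^ d} \<subseteq> veronese d (vec.span {a})"
    unfolding veronese_def
    by (rule cpoly.span_mono) (auto intro: vec.span_base)
qed

text \<open>Here \<open>T\<close> is a point of \<open>\<bbbP>(Sym\<^sup>d)\<close>, that is \<open>T \<in> cpoly.proj_space (forms d)\<close>.\<close>

definition decomposition ::
    "nat \<Rightarrow> 'n::finite cpoly set \<Rightarrow> (complex ^ 'n) set set \<Rightarrow> bool" where
  "decomposition d T A \<longleftrightarrow>
     finite A \<and> A \<subseteq> vec.proj_space UNIV \<and> T \<in> cpoly.proj_span (veronese d ` A)"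

definition minimal_decomposition ::
    "nat \<Rightarrow> 'n::finite cpoly set \<Rightarrow> (complex ^ 'n) set set \<Rightarrow> bool" where
  "minimal_decomposition d T A \<longleftrightarrow>
     decomposition d T A \<and> (\<forall>A'. A' \<subset> A \<longrightarrow> T \<notin> cpoly.proj_span (veronese d ` A'))"

definition waring_rank :: "nat \<Rightarrow> 'n::finite cpoly set \<Rightarrow> nat" where
  "waring_rank d T = (LEAST r. \<exists>A. decomposition d T A \<and> card A = r)"

definition identifiable :: "nat \<Rightarrow> 'n::finite cpoly set \<Rightarrow> bool" where
  "identifiable d T \<longleftrightarrow> (\<exists>!A. decomposition d T A \<and> card A = waring_rank d T)"

end

theory Submission
  imports Defs
    "HOL-Computational_Algebra.Polynomial_Factorial"
    "HOL-Computational_Algebra.Field_as_Ring"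
begin

text \<open>
  Let \<open>B\<close> be a decomposition of \<open>T\<close> with at most 11 points and \<open>Z = A \<union> B\<close>. Both decompositions
  express the same form, so there are coefficients with
  \<open>\<Sum>\<^bsub>P \<in> A\<^esub> a\<^sub>P f(P) = \<Sum>\<^bsub>Q \<in> B\<^esub> b\<^sub>Q f(Q)\<close> for every septic form \<open>f\<close>, and minimality of \<open>A\<close> makes
  all \<open>a\<^sub>P\<close> nonzero. If \<open>Z\<close> imposes independent conditions on septics, take \<open>f\<close> vanishing at all points
  of \<open>Z\<close> but one point \<open>P\<close> of \<open>A\<close>: the identity forces \<open>P \<in> B\<close>. Hence \<open>A \<subseteq> B\<close>, and \<open>A = B\<close> because
  \<open>B\<close> is not larger. This gives rank and uniqueness at once. It remains to show that \<open>Z\<close> imposes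
  independent conditions already on sextics, in three steps.

  \<^emph>\<open>There are three independent quartics through \<open>Z\<close>.\<close> Fix \<open>P\<^sub>0 \<in> A\<close> and let a quartic \<open>f\<close> vanish on
  \<open>B\<close> and at \<open>P\<^sub>0\<close>; these are at most 12 conditions on a space of dimension 15. The other ten points of
  \<open>A\<close> impose independent conditions on cubics, so some cubic \<open>s\<close> is nonzero at a given one of them,
  \<open>P\<close>, and zero at the remaining nine. The identity for the septic \<open>f s\<close> reads \<open>a\<^sub>P f(P) s(P) = 0\<close>,
  so \<open>f\<close> vanishes on all of \<open>A\<close> (\<open>vanishing_on_all_summands\<close>).

  \<^emph>\<open>They have no common factor.\<close> If \<open>p\<close> of degree \<open>e > 0\<close> divides them, the quotients are three
  independent forms of degree \<open>4 - e\<close> that vanish at the points of \<open>A\<close> off the curve \<open>p = 0\<close>. A line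
  contains at most 2 points of \<open>A\<close>, a conic at most 7 (a conic with 8 and the line through two more
  would be a cubic through 10), a cubic at most 9; so too many points of \<open>A\<close> are left for three
  independent quotients (\<open>general_position_no_common_factor\<close>).

  \<^emph>\<open>Quartics without a common factor have few base points.\<close> Choose a line \<open>l = 0\<close> that contains no
  common zero of the three quartics. On this line the quartics generate all binary forms of degree
  \<open>k \<ge> 7\<close>, so every form of degree \<open>k\<close> agrees on \<open>Z\<close> with \<open>l\<close> times a form of degree \<open>k - 1\<close>
  (\<open>descend_along_line\<close>). As \<open>l\<close> has no zero in \<open>Z\<close>, a form of large degree that vanishes at all points
  of \<open>Z\<close> but one can be divided down to degree 6 (\<open>no_common_zero_separated\<close>).

  These steps are carried out in an affine chart containing \<open>Z\<close>, where forms of degree \<open>d\<close> become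
  polynomials in \<open>x, y\<close> of total degree at most \<open>d\<close>, and the auxiliary lines are vertical. Linear
  functionals on the space of forms translate between powers of linear forms and values of
  polynomials.
\<close>

section \<open>Linear systems and ideals of polynomials\<close>

text \<open>Gaussian elimination: each equation costs one unknown.\<close>

lemma underdetermined_system:
  fixes m :: "'e \<Rightarrow> 'u \<Rightarrow> 'k::field"
  assumes "finite E" "finite U" "card E < card U"
  shows "\<exists>t. (\<exists>u\<in>U. t u \<noteq> 0) \<and> (\<forall>e\<in>E. (\<Sum>u\<in>U. m e u * t u) = 0)"
  using assms
proof (induction E arbitrary: U m rule: finite_induct)
  case empty
  then obtain u where "u \<in> U" by fastforce
  then show ?case by (intro exI[of _ "\<lambda>_. 1"]) auto
next
  case (insert e0 E)
  show ?case
  proof (cases "\<forall>u\<in>U. m e0 u = 0")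
    case True
    with insert.IH[of U m] insert.prems insert.hyps show ?thesis by auto
  next
    case False
    then obtain u0 where u0: "u0 \<in> U" "m e0 u0 \<noteq> 0" by blast
    define U' where "U' = U - {u0}"
    have U: "U = insert u0 U'" "u0 \<notin> U'" "finite U'" "card E < card U'"
      using insert.prems insert.hyps u0 by (auto simp: U'_def)
    obtain t where t: "\<exists>u\<in>U'. t u \<noteq> 0"
        "\<And>e. e \<in> E \<Longrightarrow> (\<Sum>u\<in>U'. (m e u - m e u0 * m e0 u / m e0 u0) * t u) = 0"
      using insert.IH[of U' "\<lambda>e u. m e u - m e u0 * m e0 u / m e0 u0"] U by blast
    define s where "s = t(u0 := - (\<Sum>u\<in>U'. m e0 u * t u) / m e0 u0)"
    have sum: "(\<Sum>u\<in>U. m e u * s u)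
        = (\<Sum>u\<in>U'. (m e u - m e u0 * m e0 u / m e0 u0) * t u)" for e
    proof -
      have "(\<Sum>u\<in>U'. m e u * s u) = (\<Sum>u\<in>U'. m e u * t u)"
        using U by (intro sum.cong) (auto simp: s_def)
      then have "(\<Sum>u\<in>U. m e u * s u)
          = (\<Sum>u\<in>U'. m e u * t u) - (\<Sum>u\<in>U'. m e u0 / m e0 u0 * (m e0 u * t u))"
        using U by (simp add: s_def sum_distrib_left sum_divide_distrib)
      then show ?thesis by (simp add: sum_subtractf algebra_simps)
    qed
    have "(\<Sum>u\<in>U. m e0 u * s u) = 0"
      unfolding sum using u0 by (simp add: sum.neutral)
    moreover have "\<exists>u\<in>U. s u \<noteq> 0"
      using t(1) U by (auto simp: s_def)
    ultimately show ?thesis using t(2) sum by (intro exI[of _ s]) auto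
  qed
qed

text \<open>Two polynomials in \<open>R[y]\<close> without a common factor of positive degree have a nonzero constant
  (a resultant) in the ideal that they generate. This is the version for arbitrary ideals: pseudo-division
  shows that an element \<open>h\<close> of least degree divides a constant multiple of every element. If \<open>h\<close> is not
  constant, a prime factor of \<open>h\<close> of positive degree cannot divide that constant, so it divides every
  element.\<close>

lemma ideal_constant_or_common_prime:
  fixes I :: "'a::{factorial_ring_gcd, semiring_gcd_mult_normalize} poly set"
  assumes add: "\<And>f g. f \<in> I \<Longrightarrow> g \<in> I \<Longrightarrow> f + g \<in> I"
    and mult: "\<And>u f. f \<in> I \<Longrightarrow> u * f \<in> I"
    and nz: "f0 \<in> I" "f0 \<noteq> 0"
  shows "(\<exists>r. r \<noteq> 0 \<and> [:r:] \<in> I) \<or> (\<exists>p. prime p \<and> degree p > 0 \<and> (\<forall>f\<in>I. p dvd f))"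
proof -
  obtain h where h: "h \<in> I" "h \<noteq> 0" and least: "\<And>g. g \<in> I \<Longrightarrow> g \<noteq> 0 \<Longrightarrow> degree h \<le> degree g"
    using nz arg_min_nat_lemma[of "\<lambda>h. h \<in> I \<and> h \<noteq> 0" f0 degree]
    by (metis (no_types, lifting))
  have pseudo: "\<exists>a. a \<noteq> 0 \<and> h dvd smult a f" if "f \<in> I" for f
  proof -
    obtain a q where aq: "a \<noteq> 0" "smult a f = h * q + pseudo_mod f h"
      using pseudo_mod(1)[OF h(2), of f] by auto
    have "pseudo_mod f h = [:a:] * f + (- q) * h"
      using aq(2) by (simp add: algebra_simps)
    also have "\<dots> \<in> I" using that h by (intro add mult)
    finally have "pseudo_mod f h = 0"
      using pseudo_mod(2)[OF h(2), of f] least by force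
    with aq show ?thesis by auto
  qed
  show ?thesis
  proof (cases "degree h = 0")
    case True
    with h show ?thesis by (metis degree_0_id pCons_0_0)
  next
    case False
    have "\<exists>p \<in># prime_factorization h. degree p > 0"
    proof (rule ccontr)
      assume "\<not> ?thesis"
      then have *: "\<forall>p \<in># prime_factorization h. degree p = 0" by simp
      have "degree (prod_mset M) = 0" if "\<forall>p \<in># M. degree p = 0" for M :: "'a poly multiset"
        using that
      proof (induction M)
        case (add p M)
        then show ?case using degree_mult_le[of p "prod_mset M"] by simp
      qed simp
      then have "degree (prod_mset (prime_factorization h)) = 0" using * by blast
      moreover have "h dvd prod_mset (prime_factorization h)"
        using prod_mset_prime_factorization_weak[OF h(2)] by (metis associated_iff_dvd)
      moreover have "prod_mset (prime_factorization h) \<noteq> 0" by auto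
      ultimately show False using False dvd_imp_degree_le[of h] by fastforce
    qed
    then obtain p where p: "prime p" "p dvd h" "degree p > 0"
      by (auto simp: in_prime_factors_iff)
    have "p dvd f" if f: "f \<in> I" for f
    proof -
      obtain a where a: "a \<noteq> 0" "h dvd smult a f" using pseudo[OF f] by blast
      then have "p dvd [:a:] * f" using p(2) by (metis dvd_trans mult_pCons_left smult_0_left add_0_right pCons_0_0 mult_zero_left)
      then have "p dvd [:a:] \<or> p dvd f" using p(1) prime_dvd_mult_iff by blast
      moreover have "\<not> p dvd [:a:]"
        using a(1) p(3) dvd_imp_degree_le[of p "[:a:]"] by auto
      ultimately show ?thesis by blast
    qed
    with p show ?thesis by blast
  qed
qed

section \<open>Bivariate polynomials and their total degree\<close>

text \<open>A polynomial in \<open>x\<close> and \<open>y\<close> is a polynomial in the outer variable \<open>y\<close> with coefficients in the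
  factorial ring of polynomials in \<open>x\<close>; so the coefficient of \<open>x\<^sup>i y\<^sup>j\<close> is \<open>coeff (coeff p j) i\<close>.\<close>

definition eval2 :: "complex poly poly \<Rightarrow> complex \<Rightarrow> complex \<Rightarrow> complex" where
  "eval2 p x y = poly (poly p [:y:]) x"

lemma eval2_simps [simp]:
  "eval2 0 x y = 0" "eval2 1 x y = 1"
  "eval2 (p + q) x y = eval2 p x y + eval2 q x y"
  "eval2 (p - q) x y = eval2 p x y - eval2 q x y"
  "eval2 (- p) x y = - eval2 p x y"
  "eval2 (p * q) x y = eval2 p x y * eval2 q x y"
  "eval2 (p ^ n) x y = eval2 p x y ^ n"
  "eval2 [:a:] x y = poly a x"
  by (simp_all add: eval2_def)

lemma eval2_pCons [simp]: "eval2 (pCons a p) x y = poly a x + y * eval2 p x y"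
  by (simp add: eval2_def)

lemma eval2_smult [simp]: "eval2 (smult a p) x y = poly a x * eval2 p x y"
  by (simp add: eval2_def)

lemma eval2_sum: "eval2 (\<Sum>i\<in>S. p i) x y = (\<Sum>i\<in>S. eval2 (p i) x y)"
  by (simp add: eval2_def poly_sum)

lemma eval2_prod: "eval2 (\<Prod>i\<in>S. p i) x y = (\<Prod>i\<in>S. eval2 (p i) x y)"
  by (simp add: eval2_def poly_prod)

lemma eval2_monom [simp]: "eval2 (monom (monom c i) j) x y = c * x ^ i * y ^ j"
  by (simp add: eval2_def poly_monom)

lemma eval2_expand:
  "eval2 p x y = (\<Sum>j\<le>degree p. \<Sum>i\<le>degree (coeff p j). coeff (coeff p j) i * x ^ i * y ^ j)"
  proof -
  have "eval2 p x y = (\<Sum>j\<le>degree p. poly (coeff p j * [:y:] ^ j) x)"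
    unfolding eval2_def by (subst poly_altdef) (simp add: poly_sum)
  also have "\<dots> = (\<Sum>j\<le>degree p. (\<Sum>i\<le>degree (coeff p j). coeff (coeff p j) i * x ^ i) * y ^ j)"
    by (simp add: poly_altdef[of "coeff p _"])
  finally show ?thesis by (simp add: sum_distrib_right)
qed

text \<open>The restriction of \<open>p\<close> to the vertical line with abscissa \<open>x\<close>.\<close>

definition specialize :: "complex \<Rightarrow> complex poly poly \<Rightarrow> complex poly" where
  "specialize x p = map_poly (\<lambda>c. poly c x) p"

lemma coeff_specialize [simp]: "coeff (specialize x p) k = poly (coeff p k) x"
  by (simp add: specialize_def coeff_map_poly)

lemma poly_specialize [simp]: "poly (specialize x p) y = eval2 p x y"
proof (induction p)
  case (pCons a p)
  have "specialize x (pCons a p) = pCons (poly a x) (specialize x p)"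
    by (rule poly_eqI) (simp add: coeff_pCons split: nat.split)
  with pCons show ?case by simp
qed (simp add: specialize_def)

lemma eval2_inject:
  assumes "\<And>x y. eval2 p x y = eval2 q x y"
  shows "p = q"
proof (rule poly_eqI)
  fix k
  have "specialize x p = specialize x q" for x
    using assms by (simp flip: poly_eq_poly_eq_iff add: fun_eq_iff)
  then have "poly (coeff p k) x = poly (coeff q k) x" for x
    by (metis coeff_specialize)
  then show "coeff p k = coeff q k"
    by (simp flip: poly_eq_poly_eq_iff add: fun_eq_iff)
qed

text \<open>The substitution \<open>x \<mapsto> x y\<close>, a chart of the blow-up of the origin. It sends \<open>x\<^sup>i y\<^sup>j\<close> to
  \<open>x\<^sup>i y\<^bsup>i + j\<^esup>\<close>, so the total degree of \<open>p\<close> becomes an ordinary degree in \<open>y\<close>, and additivity of the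
  total degree is inherited from univariate polynomials. The coefficient of \<open>y\<^sup>d\<close> is the dehomogenized
  part of \<open>p\<close> of total degree \<open>d\<close>.\<close>

definition blowup :: "complex poly poly \<Rightarrow> complex poly poly" where
  "blowup p = (\<Sum>j\<le>degree p. \<Sum>i\<le>degree (coeff p j). monom (monom (coeff (coeff p j) i) i) (i + j))"

lemma eval2_blowup: "eval2 (blowup p) x y = eval2 p (x * y) y"
  unfolding eval2_expand[of p] blowup_def
  by (simp add: eval2_sum power_add power_mult_distrib mult_ac)

lemma coeff_blowup: "coeff (coeff (blowup p) k) i = (if i \<le> k then coeff (coeff p (k - i)) i else 0)"
proof -
  have "coeff (coeff (blowup p) k) i
      = (\<Sum>j\<le>degree p. \<Sum>i'\<le>degree (coeff p j).
          if i' = i then (if i + j = k then coeff (coeff p j) i else 0) else 0)"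
    unfolding blowup_def by (simp add: coeff_sum if_distrib[of "\<lambda>p. coeff p i"] cong: if_cong)
       (intro sum.cong refl, auto intro!: sum.neutral)
  also have "\<dots> = (\<Sum>j\<le>degree p. if i + j = k then coeff (coeff p j) i else 0)"
    by (intro sum.cong refl) (auto simp: sum.delta coeff_eq_0)
  also have "\<dots> = (\<Sum>j\<le>degree p. if j = k - i then (if i \<le> k then coeff (coeff p (k - i)) i else 0) else 0)"
    by (intro sum.cong refl) auto
  also have "\<dots> = (if i \<le> k then coeff (coeff p (k - i)) i else 0)"
    by (auto simp: sum.delta coeff_eq_0)
  finally show ?thesis .
qed

lemma blowup_mult: "blowup (p * q) = blowup p * blowup q"
  by (rule eval2_inject) (simp add: eval2_blowup)

lemma blowup_eq_0_iff [simp]: "blowup p = 0 \<longleftrightarrow> p = 0"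
proof
  assume *: "blowup p = 0"
  show "p = 0"
  proof (intro poly_eqI)
    fix j i
    have "coeff (coeff p j) i = coeff (coeff (blowup p) (i + j)) i"
      by (simp add: coeff_blowup)
    then show "coeff (coeff p j) i = coeff (coeff 0 j) i" by (simp add: *)
  qed
qed (simp add: blowup_def)

definition tdeg :: "complex poly poly \<Rightarrow> nat" where
  "tdeg p = degree (blowup p)"

lemma tdeg_mult: "p \<noteq> 0 \<Longrightarrow> q \<noteq> 0 \<Longrightarrow> tdeg (p * q) = tdeg p + tdeg q"
  by (simp add: tdeg_def blowup_mult degree_mult_eq)

lemma tdeg_le_iff: "tdeg p \<le> d \<longleftrightarrow> (\<forall>i j. i + j > d \<longrightarrow> coeff (coeff p j) i = 0)"
proof
  assume *: "tdeg p \<le> d"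
  show "\<forall>i j. i + j > d \<longrightarrow> coeff (coeff p j) i = 0"
  proof (intro allI impI)
    fix i j assume "i + j > d"
    then have "coeff (coeff (blowup p) (i + j)) i = 0"
      using * by (simp add: tdeg_def coeff_eq_0)
    then show "coeff (coeff p j) i = 0" by (simp add: coeff_blowup)
  qed
next
  assume *: "\<forall>i j. i + j > d \<longrightarrow> coeff (coeff p j) i = 0"
  show "tdeg p \<le> d"
    unfolding tdeg_def
  proof (rule degree_le, intro allI impI)
    fix k assume "d < k"
    then show "coeff (blowup p) k = 0"
      using * by (intro poly_eqI) (simp add: coeff_blowup)
  qed
qed

lemma degree_le_tdeg: "degree p \<le> tdeg p"
  using tdeg_le_iff[of p "tdeg p"] by (intro degree_le) (auto intro!: poly_eqI)

definition upto_degree :: "nat \<Rightarrow> complex poly poly set" where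
  "upto_degree d = {p. tdeg p \<le> d}"

lemma upto_degree_iff: "p \<in> upto_degree d \<longleftrightarrow> (\<forall>i j. i + j > d \<longrightarrow> coeff (coeff p j) i = 0)"
  by (simp add: upto_degree_def tdeg_le_iff)

lemma upto_degree_0 [simp]: "0 \<in> upto_degree d"
  by (simp add: upto_degree_iff)

lemma upto_degree_mono: "p \<in> upto_degree d \<Longrightarrow> d \<le> e \<Longrightarrow> p \<in> upto_degree e"
  by (simp add: upto_degree_def)

lemma upto_degree_add: "p \<in> upto_degree d \<Longrightarrow> q \<in> upto_degree d \<Longrightarrow> p + q \<in> upto_degree d"
  by (simp add: upto_degree_iff)

lemma upto_degree_diff: "p \<in> upto_degree d \<Longrightarrow> q \<in> upto_degree d \<Longrightarrow> p - q \<in> upto_degree d"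
  by (simp add: upto_degree_iff)

lemma upto_degree_sum: "(\<And>i. i \<in> S \<Longrightarrow> p i \<in> upto_degree d) \<Longrightarrow> (\<Sum>i\<in>S. p i) \<in> upto_degree d"
  by (simp add: upto_degree_iff coeff_sum)

lemma upto_degree_mult: "p \<in> upto_degree d \<Longrightarrow> q \<in> upto_degree e \<Longrightarrow> p * q \<in> upto_degree (d + e)"
  using degree_mult_le[of "blowup p" "blowup q"]
  by (simp add: upto_degree_def tdeg_def blowup_mult)

lemma upto_degree_scale: "p \<in> upto_degree d \<Longrightarrow> smult [:c:] p \<in> upto_degree d"
  by (simp add: upto_degree_iff)

lemma upto_degree_const: "[:[:c:]:] \<in> upto_degree d"
  by (auto simp: upto_degree_iff coeff_pCons split: nat.split)

lemma upto_degree_power: "p \<in> upto_degree d \<Longrightarrow> p ^ n \<in> upto_degree (n * d)"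
proof (induction n)
  case 0
  show ?case using upto_degree_const[of 1] by (simp add: one_pCons)
next
  case (Suc n)
  then show ?case using upto_degree_mult[of p d "p ^ n" "n * d"] by simp
qed

lemma upto_degree_prod:
  assumes "finite S" "\<And>i. i \<in> S \<Longrightarrow> p i \<in> upto_degree 1"
  shows "(\<Prod>i\<in>S. p i) \<in> upto_degree (card S)"
  using assms
proof (induction S)
  case empty
  show ?case using upto_degree_const[of 1] by (simp add: one_pCons)
next
  case (insert i S)
  then show ?case using upto_degree_mult[of "p i" 1 "\<Prod>i\<in>S. p i" "card S"] by simp
qed

lemma upto_degree_linear: "[:[:a, b:], [:c:]:] \<in> upto_degree 1"
  by (auto simp: upto_degree_iff coeff_pCons split: nat.split)

lemma upto_degree_mult_cancel:
  assumes "p * q \<in> upto_degree d" "p \<noteq> 0" 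
  shows "q \<in> upto_degree (d - tdeg p)"
proof (cases "q = 0")
  case False
  with assms show ?thesis by (simp add: upto_degree_def tdeg_mult)
qed simp

text \<open>A curve of degree \<open>k + 1\<close> that contains a line splits off that line.\<close>

lemma vertical_line_division:
  assumes "p \<in> upto_degree (Suc k)" "\<And>y. eval2 p c y = 0"
  obtains q where "q \<in> upto_degree k" "p = [:[:-c, 1:]:] * q"
proof -
  have "specialize c p = 0"
    using assms(2) by (simp flip: poly_eq_poly_eq_iff add: fun_eq_iff)
  then have "poly (coeff p j) c = 0" for j
    by (metis coeff_0 coeff_specialize)
  then have "[:[:-c, 1:]:] dvd p"
    by (simp add: const_poly_dvd_iff poly_eq_0_iff_dvd)
  then obtain q where q: "p = [:[:-c, 1:]:] * q" by blast
  have "tdeg [:[:-c, 1:]:] > 0"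
  proof (rule ccontr)
    assume "\<not> 0 < tdeg [:[:-c, 1:]:]"
    then have "tdeg [:[:-c, 1:]:] \<le> 0" by simp
    then have "coeff (coeff [:[:-c, 1:]:] 0) 1 = 0" unfolding tdeg_le_iff by (metis less_add_one add_0_right add.commute)
    then show False by simp
  qed
  with upto_degree_mult_cancel[of "[:[:-c, 1:]:]" q "Suc k"] assms(1) q
  have "q \<in> upto_degree k"
    by (simp add: upto_degree_def)
  with q that show ?thesis by blast
qed

definition exponents :: "nat \<Rightarrow> (nat \<times> nat) set" where
  "exponents d = {(i, j). i + j \<le> d}"

lemma exponents_altdef: "exponents d = (SIGMA i:{..d}. {..d - i})"
  by (auto simp: exponents_def)

lemma finite_exponents [simp]: "finite (exponents d)"
  by (simp add: exponents_altdef)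

lemma card_exponents: "card (exponents d) = (\<Sum>i\<le>d. Suc (d - i))"
  by (simp add: exponents_altdef)

lemma upto_degree_of_coeffs: 
  "(\<Sum>(i, j)\<in>exponents d. monom (monom (g i j) i) j) \<in> upto_degree d"
  by (rule upto_degree_sum) (auto simp: upto_degree_iff exponents_def)

lemma upto_degree_expand:
  assumes "p \<in> upto_degree d"
  shows "p = (\<Sum>(i, j)\<in>exponents d. monom (monom (coeff (coeff p j) i) i) j)"
proof (intro poly_eqI)
  fix j i
  have "coeff (coeff (\<Sum>(i, j)\<in>exponents d. monom (monom (coeff (coeff p j) i) i) j) j) i
      = (\<Sum>e\<in>exponents d. if e = (i, j) then coeff (coeff p j) i else 0)"
    by (simp only: coeff_sum) (intro sum.cong refl, auto split: if_splits)
  also have "\<dots> = coeff (coeff p j) i"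
    using assms by (subst sum.delta) (simp, auto simp: exponents_def upto_degree_iff not_le)
  finally show "coeff (coeff p j) i
      = coeff (coeff (\<Sum>(i, j)\<in>exponents d. monom (monom (coeff (coeff p j) i) i) j) j) i" ..
qed

text \<open>Polynomials of bounded total degree are stable under the change of coordinates
  \<open>(x, y) \<mapsto> (x + s y, y)\<close>. It takes the vertical direction \<open>(0, 1)\<close> to \<open>(s, 1)\<close>, so every direction
  except the horizontal one can be made vertical.\<close>

lemma shear:
  assumes "p \<in> upto_degree d"
  obtains q where "q \<in> upto_degree d" "\<And>x y. eval2 q x y = eval2 p (x + s * y) y"
proof
  define l :: "complex poly poly" where "l = [:[:0, 1:], [:s:]:]"
  define q where "q = (\<Sum>(i, j)\<in>exponents d. smult [:coeff (coeff p j) i:] (l ^ i * [:0, 1:] ^ j))"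
  show "eval2 q x y = eval2 p (x + s * y) y" for x y
  proof -
    have "eval2 q x y = (\<Sum>(i, j)\<in>exponents d. coeff (coeff p j) i * (x + s * y) ^ i * y ^ j)"
      by (simp add: q_def l_def eval2_sum case_prod_unfold mult_ac)
    also have "\<dots> = eval2 (\<Sum>(i, j)\<in>exponents d. monom (monom (coeff (coeff p j) i) i) j) (x + s * y) y"
      by (simp add: eval2_sum case_prod_unfold)
    also have "\<dots> = eval2 p (x + s * y) y"
      using upto_degree_expand[OF assms] by (rule arg_cong[OF sym])
    finally show ?thesis .
  qed
  have *: "l ^ i * [:0, 1:] ^ j \<in> upto_degree (i + j)" for i j
  proof (rule upto_degree_mult)
    show "l ^ i \<in> upto_degree i"
      using upto_degree_power[OF upto_degree_linear[of 0 1 s], of i] by (simp add: l_def)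
    show "[:0, 1:] ^ j \<in> upto_degree j"
      using upto_degree_power[OF upto_degree_linear[of 0 0 1], of j] by (simp add: one_pCons)
  qed
  show "q \<in> upto_degree d"
    unfolding q_def
  proof (rule upto_degree_sum)
    fix e assume "e \<in> exponents d"
    then obtain i j where e: "e = (i, j)" "i + j \<le> d" by (auto simp: exponents_def)
    have "smult [:coeff (coeff p j) i:] (l ^ i * [:0, 1:] ^ j) \<in> upto_degree d"
      by (rule upto_degree_scale[OF upto_degree_mono[OF *[of i j] e(2)]])
    then show "(case e of (i, j) \<Rightarrow> smult [:coeff (coeff p j) i:] (l ^ i * [:0, 1:] ^ j)) \<in> upto_degree d"
      using e by simp
  qed
qed

section \<open>Points that impose independent conditions\<close>

text \<open>The points \<open>(X i, Y i)\<close> for \<open>i \<in> S\<close> impose independent conditions on polynomials of degree at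
  most \<open>d\<close>. Points are given by their coordinate functions on an index set, so that changes of
  coordinates leave the index set alone.\<close>

definition separated :: "nat \<Rightarrow> ('i \<Rightarrow> complex) \<Rightarrow> ('i \<Rightarrow> complex) \<Rightarrow> 'i set \<Rightarrow> bool" where
  "separated d X Y S \<longleftrightarrow> (\<forall>i\<in>S. \<exists>s\<in>upto_degree d.
     eval2 s (X i) (Y i) = 1 \<and> (\<forall>j\<in>S - {i}. eval2 s (X j) (Y j) = 0))"

lemma separated_subset: "separated d X Y S \<Longrightarrow> S' \<subseteq> S \<Longrightarrow> separated d X Y S'"
  unfolding separated_def by blast

lemma coeff_linear_combination:
  "coeff (coeff (\<Sum>k\<in>K. smult [:t k:] (f k)) j) i = (\<Sum>k\<in>K. t k * coeff (coeff (f k) j) i)"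
  by (simp add: coeff_sum)

lemma upto_degree_linear_combination:
  "(\<And>k. k \<in> K \<Longrightarrow> f k \<in> upto_degree d) \<Longrightarrow> (\<Sum>k\<in>K. smult [:t k:] (f k)) \<in> upto_degree d"
  by (intro upto_degree_sum upto_degree_scale)

lemma upto_degree_eq_0:
  assumes "p \<in> upto_degree d" "\<And>i j. (i, j) \<in> exponents d \<Longrightarrow> coeff (coeff p j) i = 0"
  shows "p = 0"
  by (subst upto_degree_expand[OF assms(1)]) (auto intro!: sum.neutral simp: assms(2))

text \<open>Polynomials that separate the points of \<open>S\<close> are linearly independent modulo polynomials that
  vanish on \<open>S\<close>; hence together with independent vanishing polynomials they are still independent,
  and their number is bounded by the dimension of the space of polynomials.\<close>

lemma independent_vanishing_bound:
  fixes f :: "'k \<Rightarrow> complex poly poly" and S :: "'i set"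
  assumes fin: "finite K" "finite S"
    and sep: "separated d X Y S"
    and f: "\<And>k. k \<in> K \<Longrightarrow> f k \<in> upto_degree d"
    and van: "\<And>k i. k \<in> K \<Longrightarrow> i \<in> S \<Longrightarrow> eval2 (f k) (X i) (Y i) = 0"
    and indep: "\<And>t. (\<Sum>k\<in>K. smult [:t k:] (f k)) = 0 \<Longrightarrow> \<forall>k\<in>K. t k = 0"
  shows "card K + card S \<le> card (exponents d)"
proof (rule ccontr)
  assume "\<not> ?thesis"
  then have card: "card (exponents d) < card (K <+> S)"
    using fin by (simp add: card_Plus)
  obtain s where s: "\<And>i. i \<in> S \<Longrightarrow> s i \<in> upto_degree d"
      "\<And>i j. i \<in> S \<Longrightarrow> j \<in> S \<Longrightarrow> eval2 (s i) (X j) (Y j) = (if j = i then 1 else 0)"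
    using sep unfolding separated_def by (metis Diff_iff singletonD)
  obtain t where t: "\<exists>u\<in>K <+> S. t u \<noteq> 0"
    "\<forall>e\<in>exponents d. (\<Sum>u\<in>K <+> S. coeff (coeff (case_sum f s u) (snd e)) (fst e) * t u) = 0"
    using underdetermined_system[OF _ _ card,
        of "\<lambda>e u. coeff (coeff (case_sum f s u) (snd e)) (fst e)"] fin by auto
  define g where "g = (\<Sum>u\<in>K <+> S. smult [:t u:] (case_sum f s u))"
  have "g \<in> upto_degree d"
    unfolding g_def by (rule upto_degree_linear_combination) (use f s in \<open>auto elim!: PlusE\<close>)
  moreover have "coeff (coeff g j) i = 0" if "(i, j) \<in> exponents d" for i j
    using bspec[OF t(2) that] unfolding g_def coeff_linear_combination by (simp add: mult.commute)
  ultimately have "g = 0" by (rule upto_degree_eq_0)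
  then have g0: "(\<Sum>k\<in>K. smult [:t (Inl k):] (f k)) + (\<Sum>i\<in>S. smult [:t (Inr i):] (s i)) = 0"
    using fin by (simp add: g_def sum.Plus)
  have tS: "t (Inr j) = 0" if j: "j \<in> S" for j
  proof -
    have "0 = (\<Sum>k\<in>K. t (Inl k) * eval2 (f k) (X j) (Y j)) + (\<Sum>i\<in>S. t (Inr i) * eval2 (s i) (X j) (Y j))"
      using arg_cong[OF g0, of "\<lambda>p. eval2 p (X j) (Y j)"] by (simp add: eval2_sum)
    also have "(\<Sum>k\<in>K. t (Inl k) * eval2 (f k) (X j) (Y j)) = 0"
      using van j by (simp add: sum.neutral)
    also have "(\<Sum>i\<in>S. t (Inr i) * eval2 (s i) (X j) (Y j)) = (\<Sum>i\<in>S. if i = j then t (Inr i) else 0)"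
      using s(2) j by (intro sum.cong refl) auto
    finally show ?thesis using j fin by simp
  qed
  then have "(\<Sum>k\<in>K. smult [:t (Inl k):] (f k)) = 0" using g0 by simp
  then have "\<forall>k\<in>K. t (Inl k) = 0" by (rule indep)
  with tS t(1) show False by (auto elim!: PlusE)
qed

lemma nonzero_vanishing_bound:
  assumes "finite S" "separated d X Y S" "p \<in> upto_degree d" "p \<noteq> 0"
    "\<And>i. i \<in> S \<Longrightarrow> eval2 p (X i) (Y i) = 0"
  shows "card S < card (exponents d)"
  using independent_vanishing_bound[of "{()}" S d X Y "\<lambda>_. p"] assms by simp

text \<open>Besides points, coefficients can be prescribed to vanish; this produces several linearly
  independent polynomials one after the other.\<close>

lemma exists_vanishing:
  assumes "finite S" "finite C" "card S + card C < card (exponents d)"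
  obtains f where "f \<in> upto_degree d" "f \<noteq> 0" "\<And>i. i \<in> S \<Longrightarrow> eval2 f (X i) (Y i) = 0"
    "\<And>i j. (i, j) \<in> C \<Longrightarrow> coeff (coeff f j) i = 0"
proof -
  define m where "m = (\<lambda>e (i, j). case_sum (\<lambda>k. X k ^ i * Y k ^ j) (\<lambda>c. if c = (i, j) then 1 else 0) e)"
  have "card (S <+> C) < card (exponents d)"
    using assms by (simp add: card_Plus)
  then obtain t where t: "\<exists>u\<in>exponents d. t u \<noteq> 0"
      "\<forall>e\<in>S <+> C. (\<Sum>u\<in>exponents d. m e u * t u) = 0"
    using underdetermined_system[of "S <+> C" "exponents d" m] assms by auto
  define f where "f = (\<Sum>(i, j)\<in>exponents d. monom (monom (t (i, j)) i) j)"
  have coeff: "coeff (coeff f j) i = (if (i, j) \<in> exponents d then t (i, j) else 0)" for i j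
  proof -
    have "coeff (coeff f j) i = (\<Sum>e\<in>exponents d. if e = (i, j) then t (i, j) else 0)"
      unfolding f_def coeff_sum by (intro sum.cong refl) (auto split: if_splits)
    then show ?thesis by simp
  qed
  show ?thesis
  proof
    show "f \<in> upto_degree d"
      using upto_degree_of_coeffs[of "\<lambda>i j. t (i, j)" d] by (simp add: f_def)
    from t(1) obtain i j where "(i, j) \<in> exponents d" "t (i, j) \<noteq> 0" by force
    with coeff[of j i] show "f \<noteq> 0" by auto
    show "eval2 f (X k) (Y k) = 0" if "k \<in> S" for k
    proof -
      have "(\<Sum>u\<in>exponents d. m (Inl k) u * t u) = 0"
        using t(2) that by blast
      then show ?thesis
        by (simp add: f_def eval2_sum m_def case_prod_unfold mult_ac)
    qed
    show "coeff (coeff f j) i = 0" if "(i, j) \<in> C" for i j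
    proof -
      have "(\<Sum>u\<in>exponents d. m (Inr (i, j)) u * t u) = 0"
        using t(2) that by blast
      also have "(\<Sum>u\<in>exponents d. m (Inr (i, j)) u * t u)
          = (\<Sum>u\<in>exponents d. if u = (i, j) then t (i, j) else 0)"
        by (intro sum.cong refl) (auto simp: m_def split: if_splits)
      finally have "(\<Sum>u\<in>exponents d. if u = (i, j) then t (i, j) else 0) = 0" .
      then show ?thesis by (simp add: coeff)
    qed
  qed
qed

text \<open>The multiplier trick: multiplying by polynomials \<open>s\<close> of degree \<open>e\<close> that separate \<open>A - {P0}\<close>
  isolates the single summand at \<open>i\<close> of the left-hand side, while the right-hand side is zero.\<close>

lemma vanishing_on_all_summands:
  assumes fin: "finite A" "P0 \<in> A"
    and sep: "separated e X Y (A - {P0})"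
    and eq: "\<And>g. g \<in> upto_degree (d + e) \<Longrightarrow>
      (\<Sum>i\<in>A. a i * eval2 g (X i) (Y i)) = (\<Sum>i\<in>B. b i * eval2 g (X i) (Y i))"
    and a: "\<And>i. i \<in> A \<Longrightarrow> a i \<noteq> 0"
    and f: "f \<in> upto_degree d" "\<And>i. i \<in> insert P0 B \<Longrightarrow> eval2 f (X i) (Y i) = 0"
    and i: "i \<in> A"
  shows "eval2 f (X i) (Y i) = 0"
proof (cases "i = P0")
  case False
  then obtain s where s: "s \<in> upto_degree e" "eval2 s (X i) (Y i) = 1"
      "\<And>j. j \<in> A - {P0} - {i} \<Longrightarrow> eval2 s (X j) (Y j) = 0"
    using sep i unfolding separated_def by blast
  have "(\<Sum>j\<in>A. a j * eval2 (f * s) (X j) (Y j)) = (\<Sum>j\<in>A. if j = i then a i * eval2 f (X i) (Y i) else 0)"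
  proof (intro sum.cong refl)
    fix j assume "j \<in> A"
    then show "a j * eval2 (f * s) (X j) (Y j) = (if j = i then a i * eval2 f (X i) (Y i) else 0)"
      using s f(2)[of P0] s(3)[of j] by (cases "j = P0") auto
  qed
  also have "\<dots> = a i * eval2 f (X i) (Y i)" using fin i by simp
  finally have "a i * eval2 f (X i) (Y i) = (\<Sum>j\<in>B. b j * eval2 (f * s) (X j) (Y j))"
    using eq[of "f * s"] f(1) s(1) upto_degree_mult by metis
  also have "\<dots> = 0" using f(2) by (simp add: sum.neutral)
  finally show ?thesis using a i by simp
qed (use f in auto)

section \<open>Base points of curves without a common factor\<close>

definition lift_y :: "complex poly \<Rightarrow> complex poly poly" where
  "lift_y v = map_poly (\<lambda>c. [:c:]) v"

lemma eval2_lift_y [simp]: "eval2 (lift_y v) x y = poly v y"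
  by (induction v) (simp_all add: lift_y_def map_poly_pCons)

lemma lift_y_upto_degree: "degree v \<le> d \<Longrightarrow> lift_y v \<in> upto_degree d"
  by (auto simp: lift_y_def upto_degree_iff coeff_map_poly coeff_pCons coeff_eq_0 split: nat.split)

lemma degree_specialize_le: "p \<in> upto_degree d \<Longrightarrow> degree (specialize c p) \<le> d"
proof (rule degree_le, intro allI impI)
  fix k assume "p \<in> upto_degree d" "d < k"
  then have "coeff p k = 0" by (intro poly_eqI) (simp add: upto_degree_iff)
  then show "coeff (specialize c p) k = 0" by simp
qed

lemma upto_degree_top_coeff: "p \<in> upto_degree d \<Longrightarrow> coeff p d = [:coeff (coeff p d) 0:]"
  by (auto simp: upto_degree_iff coeff_pCons intro!: poly_eqI split: nat.split)

text \<open>On the vertical line \<open>x = c\<close> the polynomials \<open>f0\<close> and \<open>f k\<close> have no common zero, since \<open>r\<close>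
  does not vanish at \<open>c\<close>; the hypothesis on \<open>f0\<close> excludes a common zero at infinity. Restricted to
  the line, \<open>g\<close> is therefore a combination of them. Reducing the coefficients of the \<open>f k\<close> modulo
  \<open>f0\<close> makes their degree less than \<open>m\<close>, which keeps all terms below the degree bound of \<open>g\<close> as soon
  as that bound is at least \<open>2 * m - 1\<close>. Lifting the coefficients to polynomials in \<open>y\<close> gives \<open>h\<close> in the
  ideal with the same restriction as \<open>g\<close>, and the difference splits off the line.\<close>

lemma descend_along_line:
  fixes f :: "'k \<Rightarrow> complex poly poly"
  assumes f0: "f0 \<in> upto_degree m" "coeff (coeff f0 m) 0 \<noteq> 0"
    and f: "finite K" "\<And>k. k \<in> K \<Longrightarrow> f k \<in> upto_degree m"
    and comb: "u0 * f0 + (\<Sum>k\<in>K. u k * f k) = [:r:]" "poly r c \<noteq> 0"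
    and g: "g \<in> upto_degree (Suc n)" "2 * m \<le> Suc (Suc n)"
  obtains q h where "q \<in> upto_degree n" "g = h + [:[:-c, 1:]:] * q"
    "\<And>x y. eval2 f0 x y = 0 \<Longrightarrow> (\<And>k. k \<in> K \<Longrightarrow> eval2 (f k) x y = 0) \<Longrightarrow> eval2 h x y = 0"
proof -
  define F0 G where "F0 = specialize c f0" and "G = specialize c g"
  define F U V where "F k = specialize c (f k)"
    and "U k = smult (1 / poly r c) (G * specialize c (u k))"
    and "V k = U k mod F0" for k
  have degF0: "degree F0 = m" "F0 \<noteq> 0"
  proof -
    have F0m: "coeff F0 m \<noteq> 0"
      using f0(2) unfolding F0_def coeff_specialize by (subst upto_degree_top_coeff[OF f0(1)]) simp
    show "degree F0 = m"
      using degree_specialize_le[OF f0(1), of c] le_degree[OF F0m] by (simp add: F0_def)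
    show "F0 \<noteq> 0" using F0m by auto
  qed
  have degF: "degree (F k) \<le> m" if "k \<in> K" for k
    using f(2)[OF that] by (simp add: F_def degree_specialize_le)
  (* For m = 0 the bound m - 1 is meaningless, but then F0 is a unit and all remainders are zero. *)
  have degV'0: "V k = 0" if "m = 0" for k
    using degF0 that is_unit_iff_degree[of F0] unit_imp_dvd[of F0 "U k"] by (simp add: V_def)
  have degV': "degree (V k) \<le> m - 1" for k
    using degF0 degV'0[of k] degree_mod_less'[of F0 "U k"] by (cases "V k = 0") (auto simp: V_def)
  have degV: "degree (V k * F k) \<le> Suc n" if "k \<in> K" for k
  proof (cases "m = 0")
    case False
    with degF[OF that] degV'[of k] degree_mult_le[of "V k" "F k"] g(2) show ?thesis by linarith
  qed (simp add: degV'0)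
  define U0 where "U0 = smult (1 / poly r c) (G * specialize c u0)"
  have split: "G = U0 * F0 + (\<Sum>k\<in>K. U k * F k)"
  proof -
    have "poly G y = poly (U0 * F0 + (\<Sum>k\<in>K. U k * F k)) y" for y
    proof -
      have "poly (U0 * F0 + (\<Sum>k\<in>K. U k * F k)) y
          = poly G y / poly r c * eval2 (u0 * f0 + (\<Sum>k\<in>K. u k * f k)) c y"
        by (simp add: U0_def F0_def U_def F_def poly_sum eval2_sum sum_distrib_left distrib_left mult_ac)
      then show ?thesis using comb by simp
    qed
    then show ?thesis by (simp flip: poly_eq_poly_eq_iff add: fun_eq_iff)
  qed
  define W where "W = U0 + (\<Sum>k\<in>K. (U k div F0) * F k)"
  have "(\<Sum>k\<in>K. U k * F k) = (\<Sum>k\<in>K. (U k div F0) * F k) * F0 + (\<Sum>k\<in>K. V k * F k)"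
    unfolding V_def sum_distrib_right sum.distrib[symmetric]
  proof (intro sum.cong refl)
    fix k
    have "U k * F k = (U k div F0 * F0 + U k mod F0) * F k" by (simp only: div_mult_mod_eq)
    then show "U k * F k = U k div F0 * F k * F0 + U k mod F0 * F k"
      by (simp only: distrib_right distrib_left mult_ac)
  qed
  with split have G: "G = W * F0 + (\<Sum>k\<in>K. V k * F k)"
    by (simp add: W_def algebra_simps)
  have "degree (W * F0) \<le> Suc n"
  proof -
    have "degree (G - (\<Sum>k\<in>K. V k * F k)) \<le> Suc n"
      using degree_specialize_le[OF g(1), of c] degV f(1)
      by (intro degree_diff_le degree_sum_le) (simp_all add: G_def)
    then show ?thesis using G by simp
  qed
  then have degW: "degree W \<le> Suc n - m"
    using degF0 by (cases "W = 0") (simp_all add: degree_mult_eq)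
  define h where "h = lift_y W * f0 + (\<Sum>k\<in>K. lift_y (V k) * f k)"
  have "h \<in> upto_degree (Suc n)"
    unfolding h_def
  proof (intro upto_degree_add upto_degree_sum)
    have "lift_y W * f0 \<in> upto_degree (Suc n - m + m)"
      using degW f0 by (intro upto_degree_mult lift_y_upto_degree)
    then show "lift_y W * f0 \<in> upto_degree (Suc n)" using g(2) by simp
    fix k assume k: "k \<in> K"
    have "lift_y (V k) * f k \<in> upto_degree (m - 1 + m)"
      using degV' f(2)[OF k] by (intro upto_degree_mult lift_y_upto_degree)
    then show "lift_y (V k) * f k \<in> upto_degree (Suc n)"
      using g(2) degV'0[of k] by (cases "m = 0") (auto elim!: upto_degree_mono simp: lift_y_def)
  qed
  moreover have "eval2 (g - h) c y = 0" for y
  proof -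
    have "eval2 h c y = poly (W * F0 + (\<Sum>k\<in>K. V k * F k)) y"
      by (simp add: h_def F0_def F_def poly_sum eval2_sum)
    then show ?thesis by (simp add: G[symmetric]) (simp add: G_def)
  qed
  ultimately obtain q where "q \<in> upto_degree n" "g - h = [:[:-c, 1:]:] * q"
    using vertical_line_division[of "g - h" n c] g(1) upto_degree_diff by blast
  moreover have "eval2 h x y = 0" if "eval2 f0 x y = 0" "\<And>k. k \<in> K \<Longrightarrow> eval2 (f k) x y = 0" for x y
    using that by (simp add: h_def eval2_sum)
  ultimately show ?thesis using that[of q h] by (metis add.commute diff_add_cancel)
qed

text \<open>A product of lines, each through one of the other points and missing the given one.\<close>

lemma separated_high_degree:
  assumes "finite Z" "inj_on (\<lambda>i. (X i, Y i)) Z"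
  shows "separated (card Z) X Y Z"
  unfolding separated_def
proof
  fix i assume i: "i \<in> Z"
  define l :: "'a \<Rightarrow> complex poly poly" where
    "l j = (if X j \<noteq> X i then [:[:- X j, 1:] , [:0:]:] else [:[:- Y j, 0:], [:1:]:])" for j
  have li: "eval2 (l j) (X i) (Y i) \<noteq> 0" if "j \<in> Z - {i}" for j
    using that i inj_onD[OF assms(2), of i j] by (auto simp: l_def)
  have lj: "eval2 (l j) (X j) (Y j) = 0" for j
    by (simp add: l_def)
  define p where "p = (\<Prod>j\<in>Z - {i}. l j)"
  have pi: "eval2 p (X i) (Y i) \<noteq> 0"
    using li assms(1) by (simp add: p_def eval2_prod)
  have "p \<in> upto_degree (card (Z - {i}))"
    unfolding p_def using assms(1) upto_degree_linear
    by (intro upto_degree_prod) (auto simp: l_def simp del: pCons_0_0)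
  then have "smult [:1 / eval2 p (X i) (Y i):] p \<in> upto_degree (card Z)"
    using assms(1) by (intro upto_degree_scale) (rule upto_degree_mono, auto intro: card_mono)
  moreover have "eval2 p (X j) (Y j) = 0" if "j \<in> Z - {i}" for j
    using that lj assms(1) by (auto simp: p_def eval2_prod)
  ultimately show "\<exists>s\<in>upto_degree (card Z). eval2 s (X i) (Y i) = 1
      \<and> (\<forall>j\<in>Z - {i}. eval2 s (X j) (Y j) = 0)"
    using pi by (intro bexI[of _ "smult [:1 / eval2 p (X i) (Y i):] p"]) auto
qed

text \<open>Base points of curves of degree \<open>m\<close> without a common component impose independent conditions
  in degree \<open>2 * m - 2\<close>, as for the complete intersection of two such curves. Since \<open>r\<close> depends on \<open>x\<close>
  alone, all but finitely many vertical lines avoid the common zeros. The factor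
  \<open>X j - c\<close> that appears in each descent step is nonzero on \<open>Z\<close>, so a separating polynomial stays
  separating up to a scalar.\<close>

lemma no_common_zero_separated:
  fixes f :: "'k \<Rightarrow> complex poly poly"
  assumes Z: "finite Z" "inj_on (\<lambda>i. (X i, Y i)) Z"
    and f0: "f0 \<in> upto_degree m" "coeff (coeff f0 m) 0 \<noteq> 0"
    and f: "finite K" "\<And>k. k \<in> K \<Longrightarrow> f k \<in> upto_degree m"
    and comb: "u0 * f0 + (\<Sum>k\<in>K. u k * f k) = [:r:]" "r \<noteq> 0"
    and van: "\<And>i. i \<in> Z \<Longrightarrow> eval2 f0 (X i) (Y i) = 0"
      "\<And>i k. i \<in> Z \<Longrightarrow> k \<in> K \<Longrightarrow> eval2 (f k) (X i) (Y i) = 0"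
  shows "separated (2 * m - 2) X Y Z"
proof -
  have "finite ({c. poly r c = 0} \<union> X ` Z)"
    using comb(2) Z(1) by (simp add: poly_roots_finite)
  then obtain c where c: "poly r c \<noteq> 0" "\<And>i. i \<in> Z \<Longrightarrow> X i \<noteq> c"
    by (metis (mono_tags, lifting) UnI1 UnI2 ex_new_if_finite image_eqI infinite_UNIV_char_0 mem_Collect_eq)
  have down: "separated d X Y Z" if sep: "separated (Suc d) X Y Z" and deg: "2 * m \<le> Suc (Suc d)" for d
    unfolding separated_def
  proof
    fix i assume i: "i \<in> Z"
    from sep i obtain s where s: "s \<in> upto_degree (Suc d)" "eval2 s (X i) (Y i) = 1"
        "\<forall>j\<in>Z - {i}. eval2 s (X j) (Y j) = 0"
      unfolding separated_def by blast
    obtain q h where qh: "q \<in> upto_degree d" "s = h + [:[:-c, 1:]:] * q"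
      "\<And>x y. eval2 f0 x y = 0 \<Longrightarrow> (\<And>k. k \<in> K \<Longrightarrow> eval2 (f k) x y = 0) \<Longrightarrow> eval2 h x y = 0"
      using descend_along_line[OF f0 f comb(1) c(1) s(1) deg] by blast
    have q: "eval2 s (X j) (Y j) = (X j - c) * eval2 q (X j) (Y j)" if "j \<in> Z" for j
      using qh(3)[of "X j" "Y j"] van that by (simp add: qh(2))
    have "smult [:X i - c:] q \<in> upto_degree d" using qh(1) by (rule upto_degree_scale)
    moreover have "eval2 q (X j) (Y j) = 0" if "j \<in> Z - {i}" for j
      using q[of j] s(3) c(2)[of j] that by auto
    moreover have "(X i - c) * eval2 q (X i) (Y i) = 1"
      using q[OF i] s(2) by simp
    ultimately show "\<exists>s\<in>upto_degree d. eval2 s (X i) (Y i) = 1 \<and> (\<forall>j\<in>Z - {i}. eval2 s (X j) (Y j) = 0)"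
      by (intro bexI[of _ "smult [:X i - c:] q"]) simp_all
  qed
  have "separated (2 * m - 2 + n) X Y Z \<Longrightarrow> separated (2 * m - 2) X Y Z" for n
  proof (induction n)
    case (Suc n)
    then show ?case using down[of "2 * m - 2 + n"] by simp
  qed simp
  moreover have "separated (2 * m - 2 + card Z) X Y Z"
    using separated_high_degree[OF Z] upto_degree_mono unfolding separated_def
    by (metis le_add2)
  ultimately show ?thesis by blast
qed

section \<open>Quartics through points in general position\<close>

text \<open>The quotients \<open>f k / p\<close> remain independent and vanish at the points of \<open>S\<close>, where \<open>p\<close> does
  not vanish.\<close>

lemma common_factor_bound:
  fixes f :: "'k \<Rightarrow> complex poly poly"
  assumes card: "card K = 3"
    and f: "\<And>k. k \<in> K \<Longrightarrow> f k \<in> upto_degree d"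
    and indep: "\<And>t. (\<Sum>k\<in>K. smult [:t k:] (f k)) = 0 \<Longrightarrow> \<forall>k\<in>K. t k = 0"
    and p: "\<And>k. k \<in> K \<Longrightarrow> p dvd f k"
    and S: "finite S" "separated (d - tdeg p) X Y S"
    and van: "\<And>k i. k \<in> K \<Longrightarrow> i \<in> S \<Longrightarrow> eval2 (f k) (X i) (Y i) = 0"
    and off: "\<And>i. i \<in> S \<Longrightarrow> eval2 p (X i) (Y i) \<noteq> 0"
  shows "3 + card S \<le> card (exponents (d - tdeg p))"
proof -
  from p obtain q where q: "\<And>k. k \<in> K \<Longrightarrow> f k = p * q k" unfolding dvd_def by metis
  have "finite K" "K \<noteq> {}" using card by (auto intro: card_ge_0_finite)
  have "p \<noteq> 0"
  proof
    assume "p = 0"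
    with q have "(\<Sum>k\<in>K. smult [:1:] (f k)) = 0" by simp
    with indep[of "\<lambda>_. 1"] \<open>K \<noteq> {}\<close> show False by auto
  qed
  have "card K + card S \<le> card (exponents (d - tdeg p))"
  proof (rule independent_vanishing_bound)
    show "q k \<in> upto_degree (d - tdeg p)" if "k \<in> K" for k
      using f[OF that] q[OF that] \<open>p \<noteq> 0\<close> upto_degree_mult_cancel by metis
    show "eval2 (q k) (X i) (Y i) = 0" if "k \<in> K" "i \<in> S" for k i
      using van[OF that] off[OF that(2)] q[OF that(1)] by simp
    show "\<forall>k\<in>K. t k = 0" if "(\<Sum>k\<in>K. smult [:t k:] (q k)) = 0" for t
    proof (rule indep)
      have "(\<Sum>k\<in>K. smult [:t k:] (f k)) = p * (\<Sum>k\<in>K. smult [:t k:] (q k))"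
        unfolding sum_distrib_left by (intro sum.cong refl) (simp add: q)
      then show "(\<Sum>k\<in>K. smult [:t k:] (f k)) = 0" by (simp add: that)
    qed
  qed (use S \<open>finite K\<close> in auto)
  with card show ?thesis by simp
qed

lemma card_exponents_values:
  "card (exponents 0) = 1" "card (exponents (Suc 0)) = 3" "card (exponents 2) = 6"
  "card (exponents 3) = 10" "card (exponents 4) = 15"
  by (simp_all add: card_exponents atMost_nat_numeral numeral_eq_Suc atMost_Suc)

text \<open>For a common factor of degree \<open>e = 1, 2, 3\<close> at least \<open>9, 4, 1\<close> points of \<open>A\<close> lie off its zero
  set, and so many points impose independent conditions in degree \<open>4 - e = 3, 2, 1\<close>. Together with
  three independent quotients this would need \<open>12, 7, 4\<close> dimensions, but there are only
  \<open>10, 6, 3\<close>. For \<open>e = 4\<close> the quotients are constants, and no two of these are independent.\<close>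

lemma general_position_no_common_factor:
  fixes A :: "'i set" and f :: "'k \<Rightarrow> complex poly poly"
  assumes A: "card A = 11"
    and k1: "\<And>S. S \<subseteq> A \<Longrightarrow> card S = 3 \<Longrightarrow> separated 1 X Y S"
    and k3: "\<And>S. S \<subseteq> A \<Longrightarrow> card S = 10 \<Longrightarrow> separated 3 X Y S"
    and K: "card K = 3"
    and f: "\<And>k. k \<in> K \<Longrightarrow> f k \<in> upto_degree 4"
    and indep: "\<And>t. (\<Sum>k\<in>K. smult [:t k:] (f k)) = 0 \<Longrightarrow> \<forall>k\<in>K. t k = 0"
    and van: "\<And>k i. k \<in> K \<Longrightarrow> i \<in> A \<Longrightarrow> eval2 (f k) (X i) (Y i) = 0"
    and p: "\<And>k. k \<in> K \<Longrightarrow> p dvd f k"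
  shows "tdeg p = 0"
proof (rule ccontr)
  assume p0: "tdeg p \<noteq> 0"
  have finA: "finite A" using A by (simp add: card_ge_0_finite)
  have "p \<noteq> 0" using p0 by (auto simp: tdeg_def blowup_def)
  define On where "On = {i \<in> A. eval2 p (X i) (Y i) = 0}"
  define Off where "Off = {i \<in> A. eval2 p (X i) (Y i) \<noteq> 0}"
  have "A = On \<union> Off" "On \<inter> Off = {}" by (auto simp: On_def Off_def)
  then have cards: "card On + card Off = 11"
    using A finA by (metis card_Un_disjoint finite_Un)
  have few: "3 + card S \<le> card (exponents (4 - tdeg p))"
    if "S \<subseteq> Off" "separated (4 - tdeg p) X Y S" for S
  proof (rule common_factor_bound[OF K f indep p])
    show "finite S" by (rule finite_subset[OF that(1)]) (simp add: Off_def finA)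
  qed (use that van in \<open>auto simp: Off_def\<close>)
  have sub3: "separated 3 X Y S" if "S \<subseteq> A" "card S \<le> 10" for S
  proof -
    have "\<exists>S'. S \<subseteq> S' \<and> S' \<subseteq> A \<and> card S' = 10"
      by (rule exists_subset_between) (use that A finA in auto)
    with k3 show ?thesis using separated_subset by blast
  qed
  have cubic: "card {i \<in> A. eval2 q (X i) (Y i) = 0} \<le> 9" if "q \<in> upto_degree 3" "q \<noteq> 0" for q
  proof (rule ccontr)
    assume "\<not> ?thesis"
    then have "10 \<le> card {i \<in> A. eval2 q (X i) (Y i) = 0}" by linarith
    then obtain S where S: "S \<subseteq> {i \<in> A. eval2 q (X i) (Y i) = 0}" "card S = 10"
      by (rule obtain_subset_with_card_n)
    moreover have "finite S" using S(2) by (simp add: card_ge_0_finite)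
    moreover have "separated 3 X Y S" using S by (intro sub3) auto
    ultimately have "card S < card (exponents 3)"
      using that by (intro nonzero_vanishing_bound[of S 3 X Y q]) auto
    with S(2) show False by (simp add: card_exponents_values)
  qed
  have line: "\<exists>l\<in>upto_degree 1. eval2 l (X i) (Y i) = 1 \<and> eval2 l (X j) (Y j) = 0 \<and> eval2 l (X k) (Y k) = 0"
    if "i \<in> A" "j \<in> A" "k \<in> A" "i \<noteq> j" "i \<noteq> k" "j \<noteq> k" for i j k
  proof -
    have "separated 1 X Y {i, j, k}" using that by (intro k1) auto
    with that show ?thesis unfolding separated_def by auto
  qed
  have tdeg_le_3: "tdeg p \<le> 3"
  proof (rule ccontr)
    assume "\<not> ?thesis"
    then have "4 - tdeg p = 0" by simp
    with few[of "{}"] show False by (simp add: separated_def card_exponents_values)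
  qed
  consider "tdeg p = 1" | "tdeg p = 2" | "tdeg p = 3" using p0 tdeg_le_3 by linarith
  then show False
  proof cases
    case 1
    have "card On \<le> 2"
    proof (rule ccontr)
      assume "\<not> ?thesis"
      then have "3 \<le> card On" by linarith
      then obtain S where S: "S \<subseteq> On" "card S = 3"
        by (rule obtain_subset_with_card_n)
      then have "separated 1 X Y S" by (intro k1) (auto simp: On_def)
      moreover have "finite S" using S(2) by (simp add: card_ge_0_finite)
      ultimately have "card S < card (exponents 1)"
        using S(1) 1 \<open>p \<noteq> 0\<close> by (intro nonzero_vanishing_bound[of S 1 X Y p])
          (auto simp: On_def upto_degree_def)
      with S(2) show False by (simp add: card_exponents_values)
    qed
    then have "9 \<le> card Off" using cards by linarith
    then obtain S where S: "S \<subseteq> Off" "card S = 9"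
      by (rule obtain_subset_with_card_n)
    then have "separated 3 X Y S" by (intro sub3) (auto simp: Off_def)
    moreover have "4 - tdeg p = 3" using 1 by simp
    ultimately show False using few[OF S(1)] S(2) by (simp add: card_exponents_values)
  next
    case 2
    have "card On \<le> 7"
    proof (rule ccontr)
      assume "\<not> ?thesis"
      then have "8 \<le> card On" by linarith
      then obtain S where S: "S \<subseteq> On" "card S = 8"
        by (rule obtain_subset_with_card_n)
      have "finite S" using S(2) by (simp add: card_ge_0_finite)
      moreover have "S \<subseteq> A" using S(1) by (auto simp: On_def)
      ultimately have "card (A - S) = 3" using S(2) A by (simp add: card_Diff_subset)
      then obtain i j k where ijk: "A - S = {i, j, k}" "i \<noteq> j" "i \<noteq> k" "j \<noteq> k"
        unfolding card_3_iff by blast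
      then have "i \<in> A" "j \<in> A" "k \<in> A" by blast+
      with ijk obtain l where l: "l \<in> upto_degree 1" "eval2 l (X i) (Y i) = 1"
          "eval2 l (X j) (Y j) = 0" "eval2 l (X k) (Y k) = 0"
        using line[of i j k] by blast
      (* The conic and the line through the points j and k form a cubic through ten points of A. *)
      have "A - {i} \<subseteq> {i \<in> A. eval2 (p * l) (X i) (Y i) = 0}"
        using ijk(1) S(1) l by (auto simp: On_def)
      then have "card (A - {i}) \<le> card {i \<in> A. eval2 (p * l) (X i) (Y i) = 0}"
        using finA by (intro card_mono) auto
      moreover have "p * l \<in> upto_degree 3" "p * l \<noteq> 0"
        using 2 l \<open>p \<noteq> 0\<close> upto_degree_mult[of p 2 l 1] by (auto simp: upto_degree_def)
      moreover have "card (A - {i}) = 10"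
        using A finA ijk(1) by (subst card_Diff_singleton) auto
      ultimately show False
        using cubic[of "p * l"] by linarith
    qed
    then have "4 \<le> card Off" using cards by linarith
    then obtain S where S: "S \<subseteq> Off" "card S = 4"
      by (rule obtain_subset_with_card_n)
    have "separated 2 X Y S"
      unfolding separated_def
    proof
      fix i assume i: "i \<in> S"
      have "card (S - {i}) = 3" using S i by (simp add: card_ge_0_finite)
      then obtain j k m where jkm: "S - {i} = {j, k, m}" "j \<noteq> k" "j \<noteq> m" "k \<noteq> m"
        unfolding card_3_iff by blast
      then have "i \<noteq> j" "i \<noteq> k" "i \<noteq> m" "i \<in> A" "j \<in> A" "k \<in> A" "m \<in> A"
        using S(1) i unfolding Off_def by blast+
      then obtain l l' where "l \<in> upto_degree 1" "eval2 l (X i) (Y i) = 1"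
          "eval2 l (X j) (Y j) = 0" "eval2 l (X k) (Y k) = 0"
          "l' \<in> upto_degree 1" "eval2 l' (X i) (Y i) = 1"
          "eval2 l' (X j) (Y j) = 0" "eval2 l' (X m) (Y m) = 0"
        using line[of i j k] line[of i j m] jkm by blast
      with upto_degree_mult[of l 1 l' 1] jkm(1)
      show "\<exists>s\<in>upto_degree 2. eval2 s (X i) (Y i) = 1 \<and> (\<forall>j\<in>S - {i}. eval2 s (X j) (Y j) = 0)"
        by (intro bexI[of _ "l * l'"]) (auto simp: numeral_2_eq_2)
    qed
    moreover have "4 - tdeg p = 2" using 2 by simp
    ultimately show False using few[OF S(1)] S(2) by (simp add: card_exponents_values)
  next
    case 3
    have "card On \<le> 9"
      using cubic[of p] 3 \<open>p \<noteq> 0\<close> by (simp add: On_def upto_degree_def)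
    then have "1 \<le> card Off" using cards by linarith
    then obtain S where S: "S \<subseteq> Off" "card S = 1"
      by (rule obtain_subset_with_card_n)
    have "separated 1 X Y S"
    proof -
      have "S \<subseteq> A" using S(1) by (auto simp: Off_def)
      then obtain S' where "S \<subseteq> S'" "S' \<subseteq> A" "card S' = 3"
        using exists_subset_between[of S 3 A] S(2) A finA by auto
      with k1 show ?thesis by (meson separated_subset)
    qed
    moreover have "4 - tdeg p = 1" using 3 by simp
    ultimately show False using few[OF S(1)] S(2) by (simp add: card_exponents_values)
  qed
qed

section \<open>Uniqueness in affine coordinates\<close>

text \<open>The hypothesis on \<open>f0\<close> says that the vertical point at infinity is not a zero of the quartic
  \<open>f0\<close>, as needed to sweep the plane by vertical lines.\<close>

lemma uniqueness_affine_monic: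
  fixes A B :: "'i set" and X Y :: "'i \<Rightarrow> complex"
  assumes A: "card A = 11" and B: "finite B" "card B \<le> 11"
    and inj: "inj_on (\<lambda>i. (X i, Y i)) (A \<union> B)"
    and k1: "\<And>S. S \<subseteq> A \<Longrightarrow> card S = 3 \<Longrightarrow> separated 1 X Y S"
    and k3: "\<And>S. S \<subseteq> A \<Longrightarrow> card S = 10 \<Longrightarrow> separated 3 X Y S"
    and a: "\<And>i. i \<in> A \<Longrightarrow> a i \<noteq> 0"
    and eq: "\<And>g. g \<in> upto_degree 7 \<Longrightarrow>
      (\<Sum>i\<in>A. a i * eval2 g (X i) (Y i)) = (\<Sum>i\<in>B. b i * eval2 g (X i) (Y i))"
    and P0: "P0 \<in> A"
    and f0: "f0 \<in> upto_degree 4" "coeff (coeff f0 4) 0 \<noteq> 0"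
      "\<And>i. i \<in> insert P0 B \<Longrightarrow> eval2 f0 (X i) (Y i) = 0"
  shows "A \<subseteq> B"
proof -
  have finA: "finite A" using A by (simp add: card_ge_0_finite)
  have cB: "card (insert P0 B) \<le> 12" "finite (insert P0 B)"
    using B by (auto simp: card_insert_if)
  (* Each new quartic misses a monomial that occurs in an earlier one: y^4 occurs in f0, and
     x^i1 y^j1 occurs in f1. So f0, f1, f2 are independent. *)
  have "card (insert P0 B) + card {(0::nat, 4::nat)} < card (exponents 4)"
    using cB by (simp add: card_exponents_values)
  from exists_vanishing[OF cB(2) _ this, of X Y] obtain f1 where f1: "f1 \<in> upto_degree 4" "f1 \<noteq> 0"
      "\<And>i. i \<in> insert P0 B \<Longrightarrow> eval2 f1 (X i) (Y i) = 0"
      "\<And>i j. (i, j) \<in> {(0, 4)} \<Longrightarrow> coeff (coeff f1 j) i = 0"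
    by (metis finite.emptyI finite.insertI)
  obtain i1 j1 where ij: "coeff (coeff f1 j1) i1 \<noteq> 0"
    using f1(2) by (metis leading_coeff_0_iff)
  have "card {(0, 4), (i1, j1)} \<le> 2" by (simp add: card_insert_if)
  then have "card (insert P0 B) + card {(0, 4), (i1, j1)} < card (exponents 4)"
    using cB by (simp add: card_exponents_values)
  from exists_vanishing[OF cB(2) _ this, of X Y] obtain f2 where f2: "f2 \<in> upto_degree 4" "f2 \<noteq> 0"
      "\<And>i. i \<in> insert P0 B \<Longrightarrow> eval2 f2 (X i) (Y i) = 0"
      "\<And>i j. (i, j) \<in> {(0, 4), (i1, j1)} \<Longrightarrow> coeff (coeff f2 j) i = 0"
    by (metis finite.emptyI finite.insertI)
  define f where "f k = (if k = 0 then f0 else if k = 1 then f1 else f2)" for k :: nat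
  have f: "f k \<in> upto_degree 4" for k
    using f0 f1 f2 by (simp add: f_def)
  have van: "eval2 (f k) (X i) (Y i) = 0" if "i \<in> A \<union> B" for i k
  proof (cases "i \<in> B")
    case True
    then show ?thesis using f0(3) f1(3) f2(3) by (simp add: f_def)
  next
    case False
    show ?thesis
    proof (rule vanishing_on_all_summands[of A P0 3 X Y 4 a b B])
      show "separated 3 X Y (A - {P0})"
        using A finA P0 by (intro k3) auto
      show "eval2 (f k) (X i) (Y i) = 0" if "i \<in> insert P0 B" for i
        using that f0(3) f1(3) f2(3) by (simp add: f_def)
    qed (use finA P0 eq a f[of k] that False in \<open>simp_all\<close>)
  qed
  have indep: "\<forall>k\<in>{0, 1, 2}. t k = 0" if "(\<Sum>k\<in>{0, 1, 2}. smult [:t k:] (f k)) = 0" for t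
  proof -
    have *: "t 0 * coeff (coeff f0 j) i + t 1 * coeff (coeff f1 j) i + t 2 * coeff (coeff f2 j) i = 0" for i j
      using arg_cong[OF that, of "\<lambda>p. coeff (coeff p j) i"] by (simp add: f_def add.assoc)
    have "t 0 = 0" using *[of 4 0] f0(2) f1(4)[of 0 4] f2(4)[of 0 4] by simp
    moreover have "t 1 = 0" using *[of j1 i1] ij f2(4)[of i1 j1] \<open>t 0 = 0\<close> by simp
    moreover obtain i j where "coeff (coeff f2 j) i \<noteq> 0"
      using f2(2) by (metis leading_coeff_0_iff)
    then have "t 2 = 0" using *[of j i] \<open>t 0 = 0\<close> \<open>t 1 = 0\<close> by simp
    ultimately show ?thesis by simp
  qed
  define I where "I = {u0 * f0 + (\<Sum>k\<in>{1, 2}. u k * f k) | u0 u. True}"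
  have I: "u0 * f0 + (\<Sum>k\<in>{1, 2}. u k * f k) \<in> I" for u0 u
    unfolding I_def by blast
  have gen: "f k \<in> I" for k
    using I[of 1 "\<lambda>_. 0"] I[of 0 "\<lambda>k. if k = 1 then 1 else 0"] I[of 0 "\<lambda>k. if k = 2 then 1 else 0"]
    by (simp add: f_def)
  have I_add: "g + h \<in> I" if "g \<in> I" "h \<in> I" for g h
  proof -
    from that obtain u0 u v0 v where "g = u0 * f0 + (\<Sum>k\<in>{1, 2}. u k * f k)" "h = v0 * f0 + (\<Sum>k\<in>{1, 2}. v k * f k)"
      unfolding I_def by blast
    then have "g + h = (u0 + v0) * f0 + (\<Sum>k\<in>{1, 2}. (u k + v k) * f k)" by (simp add: algebra_simps)
    then show ?thesis using I[of "u0 + v0" "\<lambda>k. u k + v k"] by simp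
  qed
  have I_mult: "v * g \<in> I" if "g \<in> I" for g v
  proof -
    from that obtain u0 u where "g = u0 * f0 + (\<Sum>k\<in>{1, 2}. u k * f k)"
      unfolding I_def by blast
    then have "v * g = (v * u0) * f0 + (\<Sum>k\<in>{1, 2}. (v * u k) * f k)" by (simp add: algebra_simps)
    then show ?thesis using I[of "v * u0" "\<lambda>k. v * u k"] by simp
  qed
  have f1I: "f 1 \<in> I" "f 1 \<noteq> 0" using gen[of 1] f1(2) by (simp_all add: f_def)
  have "\<exists>r. r \<noteq> 0 \<and> [:r:] \<in> I"
  proof (rule disjE[OF ideal_constant_or_common_prime[OF I_add I_mult f1I]])
    assume "\<exists>p. prime p \<and> degree p > 0 \<and> (\<forall>g\<in>I. p dvd g)"
    then obtain p where p: "degree p > 0" "\<forall>g\<in>I. p dvd g" by (elim exE conjE)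
    have "tdeg p = 0"
    proof (rule general_position_no_common_factor[OF A k1 k3])
      show "card {0, 1, 2 :: nat} = 3" by simp
      show "\<forall>k\<in>{0, 1, 2}. t k = 0" if "(\<Sum>k\<in>{0, 1, 2}. smult [:t k:] (f k)) = 0" for t
        using that by (rule indep)
      show "p dvd f k" for k using p(2) gen by (rule bspec)
    qed (use f van in simp_all)
    with p(1) degree_le_tdeg[of p] show ?thesis by simp
  qed
  then obtain r where r: "r \<noteq> 0" "[:r:] \<in> I" by (elim exE conjE)
  then obtain u0 u where "[:r:] = u0 * f0 + (\<Sum>k\<in>{1, 2}. u k * f k)"
    unfolding I_def by blast
  then have comb: "u0 * f0 + (\<Sum>k\<in>{1, 2}. u k * f k) = [:r:]" by (rule sym)
  have sep: "separated (2 * 4 - 2) X Y (A \<union> B)"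
  proof (rule no_common_zero_separated[OF _ inj f0(1,2) _ _ comb r(1)])
    show "finite (A \<union> B)" using finA B(1) by simp
    show "eval2 f0 (X i) (Y i) = 0" if "i \<in> A \<union> B" for i
      using van[OF that, of 0] by (simp add: f_def)
  qed (simp_all add: f van)
  show "A \<subseteq> B"
  proof
    fix i assume i: "i \<in> A"
    show "i \<in> B"
    proof (rule ccontr)
      assume "i \<notin> B"
      obtain s where s: "s \<in> upto_degree (2 * 4 - 2)" "eval2 s (X i) (Y i) = 1"
          "\<forall>j\<in>A \<union> B - {i}. eval2 s (X j) (Y j) = 0"
        using sep i unfolding separated_def by blast
      have "s \<in> upto_degree 7" using s(1) by (rule upto_degree_mono) simp
      note eq[OF this]
      moreover have "(\<Sum>j\<in>B. b j * eval2 s (X j) (Y j)) = 0"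
      proof (rule sum.neutral, rule ballI)
        fix j assume "j \<in> B"
        then have "j \<in> A \<union> B - {i}" using \<open>i \<notin> B\<close> by blast
        then show "b j * eval2 s (X j) (Y j) = 0" using s(3) by simp
      qed
      moreover have "(\<Sum>j\<in>A. a j * eval2 s (X j) (Y j)) = (\<Sum>j\<in>A. if j = i then a i else 0)"
        using s(2,3) by (intro sum.cong refl) simp
      ultimately show False using finA i a[OF i] by simp
    qed
  qed
qed

lemma separated_shear:
  assumes "separated d X Y S"
  shows "separated d (\<lambda>i. X i - s * Y i) Y S"
  unfolding separated_def
proof
  fix i assume "i \<in> S"
  from bspec[OF assms[unfolded separated_def] this]
  obtain p where p: "p \<in> upto_degree d" "eval2 p (X i) (Y i) = 1"
      "\<forall>j\<in>S - {i}. eval2 p (X j) (Y j) = 0"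
    by blast
  obtain q where q: "q \<in> upto_degree d" "\<And>x y. eval2 q x y = eval2 p (x + s * y) y"
    using shear[OF p(1)] by blast
  show "\<exists>p\<in>upto_degree d. eval2 p (X i - s * Y i) (Y i) = 1
      \<and> (\<forall>j\<in>S - {i}. eval2 p (X j - s * Y j) (Y j) = 0)"
    using p q by (intro bexI[of _ q]) simp_all
qed

text \<open>The extra hypothesis is reached by a shear: a quartic through \<open>Z\<close> has degree exactly 4, since no
  cubic contains ten points of \<open>A\<close>, so its leading form is nonzero in almost every direction.\<close>

lemma uniqueness_affine:
  fixes A B :: "'i set" and X Y :: "'i \<Rightarrow> complex"
  assumes A: "card A = 11" and B: "finite B" "card B \<le> 11"
    and inj: "inj_on (\<lambda>i. (X i, Y i)) (A \<union> B)"
    and k1: "\<And>S. S \<subseteq> A \<Longrightarrow> card S = 3 \<Longrightarrow> separated 1 X Y S"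
    and k3: "\<And>S. S \<subseteq> A \<Longrightarrow> card S = 10 \<Longrightarrow> separated 3 X Y S"
    and a: "\<And>i. i \<in> A \<Longrightarrow> a i \<noteq> 0"
    and eq: "\<And>g. g \<in> upto_degree 7 \<Longrightarrow>
      (\<Sum>i\<in>A. a i * eval2 g (X i) (Y i)) = (\<Sum>i\<in>B. b i * eval2 g (X i) (Y i))"
  shows "A \<subseteq> B"
proof -
  have finA: "finite A" using A by (simp add: card_ge_0_finite)
  obtain P0 where P0: "P0 \<in> A" using A by fastforce
  have cB: "card (insert P0 B) \<le> 12" "finite (insert P0 B)"
    using B by (auto simp: card_insert_if)
  from cB have room: "card (insert P0 B) + card ({} :: (nat \<times> nat) set) < card (exponents 4)"
    by (simp add: card_exponents_values)
  obtain f where f: "f \<in> upto_degree 4" "f \<noteq> 0"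
      "\<And>i. i \<in> insert P0 B \<Longrightarrow> eval2 f (X i) (Y i) = 0"
    using exists_vanishing[OF cB(2) finite.emptyI room, of X Y] by metis
  have A0: "card (A - {P0}) = 10" using A finA P0 by simp
  have fA: "eval2 f (X i) (Y i) = 0" if "i \<in> A" for i
  proof (rule vanishing_on_all_summands[of A P0 3 X Y 4 a b B])
    show "separated 3 X Y (A - {P0})" using A0 by (intro k3) auto
  qed (use finA P0 eq a f that in simp_all)
  have "f \<notin> upto_degree 3"
  proof
    assume "f \<in> upto_degree 3"
    then have "card (A - {P0}) < card (exponents 3)"
      using f(2) fA finA A0 by (intro nonzero_vanishing_bound[of _ 3 X Y f] k3) auto
    then show False by (simp add: A0 card_exponents_values)
  qed
  with f(1) have "degree (blowup f) = 4" by (auto simp: upto_degree_def tdeg_def)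
  then have "coeff (blowup f) 4 \<noteq> 0"
    using f(2) by (metis blowup_eq_0_iff leading_coeff_0_iff)
  then obtain s where s: "poly (coeff (blowup f) 4) s \<noteq> 0"
    using poly_all_0_iff_0 by blast
  obtain h where h: "h \<in> upto_degree 4" "\<And>x y. eval2 h x y = eval2 f (x + s * y) y"
    using shear[OF f(1)] by blast
  (* The leading form of f in direction (s, 1) is the coefficient of y^4 on both sides. *)
  have "specialize 0 h = specialize s (blowup f)"
    by (simp flip: poly_eq_poly_eq_iff add: fun_eq_iff h eval2_blowup)
  then have h4: "coeff (coeff h 4) 0 \<noteq> 0"
    using s by (metis coeff_specialize poly_0_coeff_0)
  show ?thesis
  proof (rule uniqueness_affine_monic[of A B "\<lambda>i. X i - s * Y i" Y a b P0 h])
    show "inj_on (\<lambda>i. (X i - s * Y i, Y i)) (A \<union> B)"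
      using inj by (auto simp: inj_on_def)
    show "(\<Sum>i\<in>A. a i * eval2 g (X i - s * Y i) (Y i)) = (\<Sum>i\<in>B. b i * eval2 g (X i - s * Y i) (Y i))"
      if g: "g \<in> upto_degree 7" for g
    proof -
      obtain q where "q \<in> upto_degree 7" "\<And>x y. eval2 q x y = eval2 g (x + (- s) * y) y"
        using shear[OF g] by blast
      with eq[of q] show ?thesis by simp
    qed
    show "eval2 h (X i - s * Y i) (Y i) = 0" if "i \<in> insert P0 B" for i
      using f(3)[OF that] by (simp add: h(2))
    show "separated 1 (\<lambda>i. X i - s * Y i) Y S" if "S \<subseteq> A" "card S = 3" for S
      using k1[OF that] by (rule separated_shear)
    show "separated 3 (\<lambda>i. X i - s * Y i) Y S" if "S \<subseteq> A" "card S = 10" for S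
      using k3[OF that] by (rule separated_shear)
  qed (fact A B a P0 h(1) h4)+
qed

section \<open>Linear functionals and projective independence\<close>

text \<open>Stated for an explicit scalar multiplication, because it is used both for coordinate vectors
  and for polynomials, where the scalar multiplication is \<open>cpoly_scale\<close>.\<close>

definition linear_functional :: "(complex \<Rightarrow> 'v \<Rightarrow> 'v) \<Rightarrow> ('v::ab_group_add \<Rightarrow> complex) \<Rightarrow> bool" where
  "linear_functional smul \<phi> \<longleftrightarrow>
    (\<forall>x y. \<phi> (x + y) = \<phi> x + \<phi> y) \<and> (\<forall>c x. \<phi> (smul c x) = c * \<phi> x)"

lemma linear_functional_scaled_sum:
  assumes "linear_functional smul \<phi>"
  shows "\<phi> (\<Sum>i\<in>S. smul (c i) (v i)) = (\<Sum>i\<in>S. c i * \<phi> (v i))"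
proof -
  have "\<phi> 0 = 0"
    using assms unfolding linear_functional_def by (metis add_cancel_right_right)
  then show ?thesis
    using assms by (induction S rule: infinite_finite_induct) (simp_all add: linear_functional_def)
qed

lemma linear_functional_sum:
  assumes "\<And>i. i \<in> S \<Longrightarrow> linear_functional smul (\<phi> i)"
  shows "linear_functional smul (\<lambda>x. \<Sum>i\<in>S. c i * \<phi> i x)"
  using assms by (simp add: linear_functional_def sum.distrib distrib_left sum_distrib_left mult.left_commute)

text \<open>Independent points have a dual system of functionals; this is how both Kruskal conditions are
  turned into statements about polynomials separating points.\<close>

lemma proj_independent_dual:
  fixes smul :: "complex \<Rightarrow> 'v::ab_group_add \<Rightarrow> 'v"
  assumes "vector_space smul" and ind: "vector_space.proj_independent smul B" and p: "p \<in> B"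
  obtains \<phi> where "linear_functional smul \<phi>" "\<And>x. x \<in> p \<Longrightarrow> x \<noteq> 0 \<Longrightarrow> \<phi> x \<noteq> 0"
    "\<And>q x. q \<in> B - {p} \<Longrightarrow> x \<in> q \<Longrightarrow> \<phi> x = 0"
proof -
  interpret vector_space smul by fact
  interpret vp: vector_space_pair smul "(*) :: complex \<Rightarrow> complex \<Rightarrow> complex" ..
  obtain r where r: "\<And>q. q \<in> B \<Longrightarrow> q = span {r q}" "independent (r ` B)"
    using ind unfolding proj_independent_def by blast
  obtain \<phi> where \<phi>: "Vector_Spaces.linear smul (*) \<phi>" "\<forall>x\<in>r ` B. \<phi> x = (if x = r p then 1 else 0)"
    using vp.linear_independent_extend[OF r(2), of "\<lambda>x. if x = r p then 1 else 0"] by blast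
  have scaled: "\<phi> (smul c x) = c * \<phi> x" for c x
    using \<phi>(1) by (rule vp.linear_scale)
  have ne: "r q \<noteq> r p" if "q \<in> B - {p}" for q
    using r(1)[of q] r(1)[OF p] that by auto
  show ?thesis
  proof
    show "linear_functional smul \<phi>"
      using scaled vp.linear_add[OF \<phi>(1)] by (simp add: linear_functional_def)
    show "\<phi> x \<noteq> 0" if "x \<in> p" "x \<noteq> 0" for x
    proof -
      have "x \<in> span {r p}" using r(1)[OF p] that(1) by simp
      then obtain k where "x = smul k (r p)" unfolding span_singleton by blast
      with that(2) p \<phi>(2) show ?thesis by (auto simp: scaled)
    qed
    show "\<phi> x = 0" if "q \<in> B - {p}" "x \<in> q" for q x
    proof -
      have "x \<in> span {r q}" using r(1)[of q] that by simp
      then obtain k where "x = smul k (r q)" unfolding span_singleton by blast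
      with ne[OF that(1)] that(1) \<phi>(2) show ?thesis by (auto simp: scaled)
    qed
  qed
qed

lemma (in vector_space) kruskal_rank_independent:
  assumes "finite B" "kruskal_rank B = k"
  shows "S \<subseteq> B \<Longrightarrow> card S \<le> k \<Longrightarrow> local.proj_independent S"
proof -
  let ?K = "{k. k \<le> card B \<and> (\<forall>B'. B' \<subseteq> B \<and> card B' \<le> k \<longrightarrow> local.proj_independent B')}"
  have "0 \<in> ?K"
  proof (intro CollectI conjI allI impI)
    fix B' assume "B' \<subseteq> B \<and> card B' \<le> 0"
    then have "B' = {}" using assms(1) by (metis card_eq_0_iff finite_subset le_zero_eq)
    then show "local.proj_independent B'" by (simp add: proj_independent_def independent_empty)
  qed simp
  moreover have "finite ?K"
  proof (rule finite_subset)
    show "?K \<subseteq> {..card B}" by blast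
  qed simp
  ultimately have "Max ?K \<in> ?K" by (intro Max_in) blast+
  then have "k \<in> ?K" unfolding assms(2)[symmetric] kruskal_rank_def .
  then show "S \<subseteq> B \<Longrightarrow> card S \<le> k \<Longrightarrow> local.proj_independent S" by blast
qed

section \<open>Functionals on forms and polynomial functions\<close>

definition total_degree :: "('n::finite \<Rightarrow>\<^sub>0 nat) \<Rightarrow> nat" where
  "total_degree m = (\<Sum>i\<in>UNIV. Poly_Mapping.lookup m i)"

definition monomial_value :: "complex ^ 'n \<Rightarrow> ('n::finite \<Rightarrow>\<^sub>0 nat) \<Rightarrow> complex" where
  "monomial_value a m = (\<Prod>i\<in>UNIV. (a $ i) ^ Poly_Mapping.lookup m i)"

lemma total_degree_add: "total_degree (m + n) = total_degree m + total_degree n"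
  by (simp add: total_degree_def lookup_add sum.distrib)

lemma total_degree_single [simp]: "total_degree (Poly_Mapping.single i k) = k"
  by (simp add: total_degree_def lookup_single when_def)

lemma total_degree_0 [simp]: "total_degree m = 0 \<longleftrightarrow> m = 0"
proof -
  have "total_degree m = 0 \<longleftrightarrow> (\<forall>i. Poly_Mapping.lookup m i = 0)"
    by (simp add: total_degree_def)
  then show ?thesis by (metis lookup_zero poly_mapping_eqI)
qed

lemma monomial_value_add: "monomial_value a (m + n) = monomial_value a m * monomial_value a n"
  by (simp add: monomial_value_def lookup_add power_add prod.distrib)

lemma monomial_value_single [simp]: "monomial_value a (Poly_Mapping.single i k) = (a $ i) ^ k"
proof -
  have "monomial_value a (Poly_Mapping.single i k) = (\<Prod>j\<in>UNIV. if j = i then (a $ i) ^ k else 1)"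
    unfolding monomial_value_def by (intro prod.cong refl) (auto simp: lookup_single when_def)
  then show ?thesis by simp
qed

lemma monomial_value_0 [simp]: "monomial_value a 0 = 1"
  by (simp add: monomial_value_def)

lemma lookup_single_times:
  fixes p :: "'n cpoly"
  shows "Poly_Mapping.lookup (Poly_Mapping.single (Poly_Mapping.single i 1) c * p) m
    = (if Poly_Mapping.lookup m i = 0 then 0 else c * Poly_Mapping.lookup p (m - Poly_Mapping.single i 1))"
proof -
  have split: "m = Poly_Mapping.single i 1 + q \<longleftrightarrow> Poly_Mapping.lookup m i \<noteq> 0 \<and> q = m - Poly_Mapping.single i 1" for q
  proof
    assume "m = Poly_Mapping.single i 1 + q"
    then show "Poly_Mapping.lookup m i \<noteq> 0 \<and> q = m - Poly_Mapping.single i 1"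
      by (simp add: lookup_add)
  next
    assume *: "Poly_Mapping.lookup m i \<noteq> 0 \<and> q = m - Poly_Mapping.single i 1"
    then show "m = Poly_Mapping.single i 1 + q"
      by (intro poly_mapping_eqI) (auto simp: lookup_add lookup_minus lookup_single when_def)
  qed
  have "Poly_Mapping.lookup (Poly_Mapping.single (Poly_Mapping.single i 1) c * p) m
      = c * (\<Sum>q. Poly_Mapping.lookup p q when m = Poly_Mapping.single i 1 + q)"
    by (simp add: lookup_mult lookup_single when_mult)
  then show ?thesis
    unfolding split by (simp add: when_def)
qed

lemma lookup_cpoly_scale [simp]:
  fixes p :: "'n cpoly"
  shows "Poly_Mapping.lookup (cpoly_scale c p) m = c * Poly_Mapping.lookup p m"
  by (simp add: cpoly_scale_def lookup_mult lookup_single when_mult)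

text \<open>The multinomial theorem. Only the fact that the multinomial coefficients \<open>\<kappa> m\<close> are nonzero and
  do not depend on \<open>a\<close> matters, so they are obtained from the recursion of Pascal's rule.\<close>

lemma lookup_linear_form_power:
  "\<exists>\<kappa>. (\<forall>m. total_degree m = d \<longrightarrow> \<kappa> m \<noteq> (0::nat)) \<and>
    (\<forall>a m. total_degree m = d \<longrightarrow>
      Poly_Mapping.lookup (linear_form a ^ d) m = of_nat (\<kappa> m) * monomial_value (a :: complex ^ 'n::finite) m)"
proof (induction d)
  case 0
  show ?case by (rule exI[of _ "\<lambda>_. 1"]) simp
next
  case (Suc d)
  then obtain \<kappa> where \<kappa>: "\<And>m. total_degree m = d \<Longrightarrow> \<kappa> m \<noteq> (0::nat)"
    "\<And>(a :: complex ^ 'n) m. total_degree m = d \<Longrightarrow>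
      Poly_Mapping.lookup (linear_form a ^ d) m = of_nat (\<kappa> m) * monomial_value a m"
    by blast
  define \<kappa>' where "\<kappa>' m = (\<Sum>i\<in>UNIV. if Poly_Mapping.lookup m i = 0 then 0
      else \<kappa> (m - Poly_Mapping.single i 1))" for m :: "'n \<Rightarrow>\<^sub>0 nat"
  have down: "m = Poly_Mapping.single i 1 + (m - Poly_Mapping.single i 1)"
    if "Poly_Mapping.lookup m i \<noteq> 0" for m :: "'n \<Rightarrow>\<^sub>0 nat" and i
    using that by (intro poly_mapping_eqI) (auto simp: lookup_add lookup_minus lookup_single when_def)
  have deg: "total_degree (m - Poly_Mapping.single i 1) = d"
    if "total_degree m = Suc d" "Poly_Mapping.lookup m i \<noteq> 0" for m :: "'n \<Rightarrow>\<^sub>0 nat" and i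
    using arg_cong[OF down[OF that(2)], of total_degree] that(1) by (simp add: total_degree_add)
  show ?case
  proof (intro exI[of _ \<kappa>'] conjI allI impI)
    fix m :: "'n \<Rightarrow>\<^sub>0 nat" assume m: "total_degree m = Suc d"
    then obtain i where i: "Poly_Mapping.lookup m i \<noteq> 0"
      unfolding total_degree_def by (metis nat.distinct(1) sum.neutral)
    with \<kappa>(1)[OF deg[OF m i]] show "\<kappa>' m \<noteq> 0"
      unfolding \<kappa>'_def by (auto simp: sum_eq_0_iff)
  next
    fix a :: "complex ^ 'n" and m :: "'n \<Rightarrow>\<^sub>0 nat" assume m: "total_degree m = Suc d"
    have "Poly_Mapping.lookup (linear_form a ^ Suc d) m
        = (\<Sum>i\<in>UNIV. if Poly_Mapping.lookup m i = 0 then 0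
            else a $ i * Poly_Mapping.lookup (linear_form a ^ d) (m - Poly_Mapping.single i 1))"
    proof -
      have "linear_form a ^ Suc d
          = (\<Sum>i\<in>UNIV. Poly_Mapping.single (Poly_Mapping.single i 1) (a $ i) * linear_form a ^ d)"
        unfolding power_Suc by (subst linear_form_def) (simp only: sum_distrib_right)
      then show ?thesis by (simp only: lookup_sum lookup_single_times)
    qed
    also have "\<dots> = (\<Sum>i\<in>UNIV. of_nat (if Poly_Mapping.lookup m i = 0 then 0
      else \<kappa> (m - Poly_Mapping.single i 1)) * monomial_value a m)"
    proof (intro sum.cong refl)
      fix i
      show "(if Poly_Mapping.lookup m i = 0 then 0
            else a $ i * Poly_Mapping.lookup (linear_form a ^ d) (m - Poly_Mapping.single i 1))
          = of_nat (if Poly_Mapping.lookup m i = 0 then 0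
              else \<kappa> (m - Poly_Mapping.single i 1)) * monomial_value a m"
      proof (cases "Poly_Mapping.lookup m i = 0")
        case False
        have "monomial_value a m = a $ i * monomial_value a (m - Poly_Mapping.single i 1)"
          by (subst down[OF False]) (simp add: monomial_value_add)
        with False \<kappa>(2)[OF deg[OF m False]] show ?thesis by simp
      qed simp
    qed
    also have "\<dots> = of_nat (\<kappa>' m) * monomial_value a m"
      by (simp add: \<kappa>'_def sum_distrib_right)
    finally show "Poly_Mapping.lookup (linear_form a ^ Suc d) m = of_nat (\<kappa>' m) * monomial_value a m" .
  qed
qed

lemma monomial_value_as_functional:
  fixes m :: "'n::finite \<Rightarrow>\<^sub>0 nat"
  assumes "total_degree m = d"
  obtains \<phi> where "linear_functional cpoly_scale \<phi>" "\<And>a. \<phi> (linear_form a ^ d) = monomial_value a m"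
proof -
  obtain \<kappa> where \<kappa>: "\<kappa> m \<noteq> (0::nat)"
    "\<And>a :: complex ^ 'n. Poly_Mapping.lookup (linear_form a ^ d) m = of_nat (\<kappa> m) * monomial_value a m"
    using lookup_linear_form_power[of d] assms by metis
  show ?thesis
  proof
    show "linear_functional cpoly_scale (\<lambda>p :: 'n cpoly. Poly_Mapping.lookup p m / of_nat (\<kappa> m))"
      by (simp add: linear_functional_def lookup_add add_divide_distrib lookup_cpoly_scale)
    show "Poly_Mapping.lookup (linear_form a ^ d) m / of_nat (\<kappa> m) = monomial_value a m" for a
      using \<kappa> by simp
  qed
qed

text \<open>Apolarity, in the direction from polynomials to functionals: evaluation of a form of degree \<open>d\<close>
  at \<open>a\<close> is a linear functional of \<open>linear_form a ^ d\<close>. The chart has \<open>h = w \<bullet> a\<close> as its line at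
  infinity, so \<open>x\<^sup>i y\<^sup>j\<close> corresponds to the form \<open>a\<^sub>1\<^sup>i a\<^sub>2\<^sup>j h\<^bsup>d - i - j\<^esup>\<close>, which is expanded into monomials one
  factor \<open>h\<close> at a time.\<close>

lemma functional_of_polynomial:
  assumes g: "g \<in> upto_degree d"
  obtains \<phi> where "linear_functional cpoly_scale \<phi>"
    "\<And>a h x y. a $ 1 = h * x \<Longrightarrow> a $ 2 = h * y \<Longrightarrow> h = (\<Sum>i\<in>UNIV. w $ i * a $ i) \<Longrightarrow>
      \<phi> (linear_form (a :: complex ^ 3) ^ d) = h ^ d * eval2 g x y"
proof -
  have mono: "\<exists>\<phi>. linear_functional cpoly_scale \<phi> \<and>
      (\<forall>a :: complex ^ 3. \<phi> (linear_form a ^ d) = monomial_value a m * (\<Sum>i\<in>UNIV. w $ i * a $ i) ^ k)"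
    if "total_degree m + k = d" for m k
    using that
  proof (induction k arbitrary: m)
    case 0
    then show ?case using monomial_value_as_functional[of m d] by (metis add.right_neutral mult.right_neutral power_0)
  next
    case (Suc k)
    have "total_degree (m + Poly_Mapping.single i 1) + k = d" for i
      using Suc.prems by (simp add: total_degree_add)
    then have "\<exists>\<phi>. linear_functional cpoly_scale \<phi> \<and> (\<forall>a :: complex ^ 3. \<phi> (linear_form a ^ d)
        = monomial_value a (m + Poly_Mapping.single i 1) * (\<Sum>i\<in>UNIV. w $ i * a $ i) ^ k)" for i
      by (rule Suc.IH)
    then obtain \<phi> where \<phi>: "\<And>i. linear_functional cpoly_scale (\<phi> i)"
      "\<And>i (a :: complex ^ 3). \<phi> i (linear_form a ^ d)
        = monomial_value a (m + Poly_Mapping.single i 1) * (\<Sum>i\<in>UNIV. w $ i * a $ i) ^ k"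
      by metis
    have "linear_functional cpoly_scale (\<lambda>p. \<Sum>i\<in>UNIV. w $ i * \<phi> i p)"
      using \<phi>(1) by (rule linear_functional_sum)
    moreover have "(\<Sum>i\<in>UNIV. w $ i * \<phi> i (linear_form a ^ d))
        = monomial_value a m * (\<Sum>i\<in>UNIV. w $ i * a $ i) ^ Suc k" for a :: "complex ^ 3"
    proof -
      have "(\<Sum>i\<in>UNIV. w $ i * \<phi> i (linear_form a ^ d))
          = (\<Sum>i\<in>UNIV. (w $ i * a $ i) * (monomial_value a m * (\<Sum>i\<in>UNIV. w $ i * a $ i) ^ k))"
        by (intro sum.cong refl) (simp add: \<phi>(2) monomial_value_add)
      also have "\<dots> = monomial_value a m * (\<Sum>i\<in>UNIV. w $ i * a $ i) ^ Suc k"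
        by (subst sum_distrib_right[symmetric]) (simp add: mult_ac)
      finally show ?thesis .
    qed
    ultimately show ?case by blast
  qed
  define mon where "mon e = Poly_Mapping.single (1::3) (fst e) + Poly_Mapping.single 2 (snd e)" for e :: "nat \<times> nat"
  have "\<forall>e\<in>exponents d. \<exists>\<phi>. linear_functional cpoly_scale \<phi> \<and> (\<forall>a :: complex ^ 3. \<phi> (linear_form a ^ d)
      = monomial_value a (mon e) * (\<Sum>i\<in>UNIV. w $ i * a $ i) ^ (d - fst e - snd e))"
    by (intro ballI mono) (auto simp: exponents_def mon_def total_degree_add)
  from bchoice[OF this] obtain \<phi> where \<phi>': "\<forall>e\<in>exponents d. linear_functional cpoly_scale (\<phi> e) \<and>
      (\<forall>a :: complex ^ 3. \<phi> e (linear_form a ^ d)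
        = monomial_value a (mon e) * (\<Sum>i\<in>UNIV. w $ i * a $ i) ^ (d - fst e - snd e))"
    by (elim exE)
  have \<phi>: "linear_functional cpoly_scale (\<phi> e)"
    "\<phi> e (linear_form a ^ d) = monomial_value a (mon e) * (\<Sum>i\<in>UNIV. w $ i * a $ i) ^ (d - fst e - snd e)"
    if "e \<in> exponents d" for e and a :: "complex ^ 3"
    using bspec[OF \<phi>' that] by simp_all
  define c where "c e = coeff (coeff g (snd e)) (fst e)" for e
  show ?thesis
  proof
    show "linear_functional cpoly_scale (\<lambda>p. \<Sum>e\<in>exponents d. c e * \<phi> e p)"
      using \<phi>(1) by (rule linear_functional_sum)
    fix a :: "complex ^ 3" and h x y
    assume a: "a $ 1 = h * x" "a $ 2 = h * y" "h = (\<Sum>i\<in>UNIV. w $ i * a $ i)"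
    have "c e * \<phi> e (linear_form a ^ d) = h ^ d * (c e * x ^ fst e * y ^ snd e)" if "e \<in> exponents d" for e
    proof -
      have "d = fst e + snd e + (d - fst e - snd e)" using that by (auto simp: exponents_def)
      then have "h ^ d = h ^ fst e * h ^ snd e * h ^ (d - fst e - snd e)" by (metis power_add)
      then show ?thesis
        by (simp add: \<phi>(2)[OF that, of a] mon_def monomial_value_add a(1,2) flip: a(3))
          (simp add: power_mult_distrib)
    qed
    then have "(\<Sum>e\<in>exponents d. c e * \<phi> e (linear_form a ^ d))
        = h ^ d * (\<Sum>e\<in>exponents d. c e * x ^ fst e * y ^ snd e)"
      unfolding sum_distrib_left by (rule sum.cong[OF refl])
    also have "(\<Sum>e\<in>exponents d. c e * x ^ fst e * y ^ snd e)
        = eval2 (\<Sum>(i, j)\<in>exponents d. monom (monom (coeff (coeff g j) i) i) j) x y"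
      by (simp add: eval2_sum case_prod_unfold c_def)
    also have "\<dots> = eval2 g x y"
      using upto_degree_expand[OF g] by (rule arg_cong[OF sym])
    finally show "(\<Sum>e\<in>exponents d. c e * \<phi> e (linear_form a ^ d)) = h ^ d * eval2 g x y" .
  qed
qed

text \<open>The converse direction: a functional of \<open>linear_form a ^ d\<close> is a form of degree \<open>d\<close> in \<open>a\<close>,
  hence a polynomial in the coordinates of a chart with coordinate functions \<open>\<zeta>\<close>. One factor
  \<open>linear_form a\<close> is expanded at a time.\<close>

lemma polynomial_of_functional:
  fixes \<zeta> :: "'n::finite \<Rightarrow> complex poly poly"
  assumes "linear_functional cpoly_scale \<phi>" and \<zeta>: "\<And>i. \<zeta> i \<in> upto_degree 1"
  shows "\<exists>p\<in>upto_degree d. \<forall>a h x y. (\<forall>i. a $ i = h * eval2 (\<zeta> i) x y) \<longrightarrow>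
    \<phi> (linear_form a ^ d) = h ^ d * eval2 p x y"
  using assms(1)
proof (induction d arbitrary: \<phi>)
  case 0
  show ?case by (rule bexI[of _ "[:[:\<phi> 1:]:]"]) (simp_all add: upto_degree_const)
next
  case (Suc d)
  let ?e = "\<lambda>i. Poly_Mapping.single (Poly_Mapping.single i 1) 1 :: 'n cpoly"
  have lin: "linear_functional cpoly_scale (\<lambda>q. \<phi> (?e i * q))" for i
    using Suc.prems by (simp add: linear_functional_def distrib_left cpoly_scale_def mult.left_commute)
  have "\<forall>i. \<exists>p. p \<in> upto_degree d \<and> (\<forall>a h x y. (\<forall>j. a $ j = h * eval2 (\<zeta> j) x y) \<longrightarrow>
      \<phi> (?e i * linear_form a ^ d) = h ^ d * eval2 p x y)"
    using Suc.IH[OF lin] by (simp only: Bex_def) simp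
  from choice[OF this] obtain p where p': "\<forall>i. p i \<in> upto_degree d \<and>
      (\<forall>a h x y. (\<forall>j. a $ j = h * eval2 (\<zeta> j) x y) \<longrightarrow>
        \<phi> (?e i * linear_form a ^ d) = h ^ d * eval2 (p i) x y)"
    by (elim exE)
  then have p: "p i \<in> upto_degree d" for i by blast
  have p2: "\<phi> (?e i * linear_form a ^ d) = h ^ d * eval2 (p i) x y"
    if "\<forall>j. a $ j = h * eval2 (\<zeta> j) x y" for i a h x y
    using p' that by blast
  have "(\<Sum>i\<in>UNIV. \<zeta> i * p i) \<in> upto_degree (Suc d)"
    using upto_degree_mult[OF \<zeta> p] by (intro upto_degree_sum) simp
  moreover have "\<phi> (linear_form a ^ Suc d) = h ^ Suc d * eval2 (\<Sum>i\<in>UNIV. \<zeta> i * p i) x y"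
    if a: "\<forall>i. a $ i = h * eval2 (\<zeta> i) x y" for a h x y
  proof -
    have "linear_form a ^ Suc d = (\<Sum>i\<in>UNIV. cpoly_scale (a $ i) (?e i * linear_form a ^ d))"
      unfolding power_Suc
      by (subst linear_form_def) (simp add: sum_distrib_right cpoly_scale_def mult_single flip: mult.assoc)
    then have "\<phi> (linear_form a ^ Suc d) = (\<Sum>i\<in>UNIV. a $ i * \<phi> (?e i * linear_form a ^ d))"
      using linear_functional_scaled_sum[OF Suc.prems] by simp
    also have "\<dots> = h ^ Suc d * eval2 (\<Sum>i\<in>UNIV. \<zeta> i * p i) x y"
      unfolding eval2_sum sum_distrib_left p2[OF a] a[rule_format]
      by (intro sum.cong refl) (simp add: mult_ac)
    finally show ?thesis .
  qed
  ultimately show ?case by blast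
qed

lemma span_singleton_scale:
  fixes a b :: "complex ^ 'n"
  assumes "a = s *s b" "s \<noteq> 0"
  shows "vec.span {a} = vec.span {b}"
proof -
  have sub: "vec.span {x} \<subseteq> vec.span {y}" if "x = k *s y" for x y :: "complex ^ 'n" and k
    using that by (intro vec.span_minimal) (auto intro: vec.span_scale vec.span_base)
  have "b = (1 / s) *s a" using assms by simp
  with sub[OF assms(1)] sub[of b "1 / s" a] show ?thesis by blast
qed

text \<open>The monomials \<open>a\<^sub>i\<^sup>d a\<^sub>j\<close> with \<open>a\<^sub>i \<noteq> 0\<close> recover the ratios of all coordinates of \<open>a\<close>.\<close>

lemma veronese_inject:
  fixes a b :: "complex ^ 'n::finite"
  assumes eq: "veronese (Suc d) (vec.span {a}) = veronese (Suc d) (vec.span {b})" and a: "a \<noteq> 0"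
  shows "vec.span {a} = vec.span {b}"
proof -
  have "linear_form a ^ Suc d \<in> cpoly.span {linear_form b ^ Suc d}"
    using eq unfolding veronese_point by (metis cpoly.span_base singletonI)
  then obtain c where c: "linear_form a ^ Suc d = cpoly_scale c (linear_form b ^ Suc d)"
    unfolding cpoly.span_singleton by blast
  have mono: "monomial_value a m = c * monomial_value b m" if "total_degree m = Suc d" for m
    using monomial_value_as_functional[OF that] c unfolding linear_functional_def by metis
  obtain i where i: "a $ i \<noteq> 0" using a by (metis vec_eq_iff zero_index)
  have ai: "a $ i ^ d * a $ j = c * (b $ i ^ d * b $ j)" for j
    using mono[of "Poly_Mapping.single i d + Poly_Mapping.single j 1"]
    by (simp add: total_degree_add monomial_value_add)
  from ai[of i] i have nz: "c \<noteq> 0" "b $ i ^ d \<noteq> 0" by auto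
  define s where "s = c * b $ i ^ d / a $ i ^ d"
  have "s \<noteq> 0" using nz i by (simp add: s_def)
  have "a $ j = s * b $ j" for j
    using ai[of j] i by (simp add: s_def field_simps)
  then have "a = s *s b" by (simp add: vec_eq_iff)
  then show ?thesis using \<open>s \<noteq> 0\<close> by (rule span_singleton_scale)
qed

section \<open>Projective points in an affine chart\<close>

lemma separatedI:
  assumes "\<And>i. i \<in> S \<Longrightarrow> \<exists>p\<in>upto_degree d. eval2 p (X i) (Y i) \<noteq> 0 \<and> (\<forall>j\<in>S - {i}. eval2 p (X j) (Y j) = 0)"
  shows "separated d X Y S"
  unfolding separated_def
proof
  fix i assume "i \<in> S"
  from assms[OF this] obtain p where p: "p \<in> upto_degree d" "eval2 p (X i) (Y i) \<noteq> 0"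
      "\<forall>j\<in>S - {i}. eval2 p (X j) (Y j) = 0"
    by (elim bexE conjE)
  show "\<exists>s\<in>upto_degree d. eval2 s (X i) (Y i) = 1 \<and> (\<forall>j\<in>S - {i}. eval2 s (X j) (Y j) = 0)"
    by (rule bexI[of _ "smult [:1 / eval2 p (X i) (Y i):] p"])
      (use p upto_degree_scale in simp_all)
qed

definition rep :: "(complex ^ 'n::finite) set \<Rightarrow> complex ^ 'n" where
  "rep P = (SOME a. a \<noteq> 0 \<and> P = vec.span {a})"

lemma rep:
  assumes "P \<in> vec.proj_space UNIV"
  shows "rep P \<noteq> 0" "vec.span {rep P} = P"
proof -
  from assms obtain a where "P = vec.span {a}" "a \<noteq> 0"
    unfolding vec.proj_space_def by blast
  then have "rep P \<noteq> 0 \<and> P = vec.span {rep P}"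
    unfolding rep_def by (intro someI[of "\<lambda>a. a \<noteq> 0 \<and> P = vec.span {a}" a]) simp
  then show "rep P \<noteq> 0" "vec.span {rep P} = P" by simp_all
qed

lemma veronese_rep:
  assumes "P \<in> vec.proj_space UNIV"
  shows "veronese d P = cpoly.span {linear_form (rep P) ^ d}"
  using veronese_point[of d "rep P"] rep(2)[OF assms] by simp

lemma linear_form_power_nonzero:
  assumes "a \<noteq> 0"
  shows "linear_form a ^ d \<noteq> 0"
proof
  assume 0: "linear_form a ^ d = 0"
  obtain i where i: "a $ i \<noteq> 0" using assms by (auto simp: vec_eq_iff)
  have deg: "total_degree (Poly_Mapping.single i d) = d" by simp
  obtain \<phi> where \<phi>: "linear_functional cpoly_scale \<phi>"
      "\<And>a. \<phi> (linear_form a ^ d) = monomial_value a (Poly_Mapping.single i d)"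
    using monomial_value_as_functional[OF deg] by metis
  have "\<phi> 0 = 0" using linear_functional_scaled_sum[OF \<phi>(1), of _ _ "{}"] by simp
  then show False using \<phi>(2)[of a] 0 i by simp
qed

text \<open>The span of the Veronese points, with one representative power for each point.\<close>

lemma decomposition_iff_sum:
  assumes "finite A" "A \<subseteq> vec.proj_space UNIV"
  shows "T \<in> cpoly.proj_span (veronese d ` A) \<longleftrightarrow>
    (\<exists>v. v \<noteq> 0 \<and> T = cpoly.span {v} \<and> (\<exists>a. v = (\<Sum>P\<in>A. cpoly_scale (a P) (linear_form (rep P) ^ d))))"
proof -
  let ?L = "\<lambda>P. linear_form (rep P) ^ d"
  let ?V = "{v. \<exists>a. v = (\<Sum>P\<in>A. cpoly_scale (a P) (?L P))}"
  have "cpoly.span (\<Union> (veronese d ` A)) = ?V"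
  proof
    have "cpoly.subspace ?V"
    proof (rule cpoly.subspaceI)
      show "0 \<in> ?V" by (rule CollectI, rule exI[of _ "\<lambda>_. 0"]) simp
    next
      fix v w assume "v \<in> ?V" "w \<in> ?V"
      then obtain a b where "v = (\<Sum>P\<in>A. cpoly_scale (a P) (?L P))" "w = (\<Sum>P\<in>A. cpoly_scale (b P) (?L P))"
        by blast
      then have "v + w = (\<Sum>P\<in>A. cpoly_scale (a P + b P) (?L P))"
        by (simp add: cpoly.scale_left_distrib sum.distrib)
      then show "v + w \<in> ?V" by (intro CollectI exI[of _ "\<lambda>P. a P + b P"])
    next
      fix c v assume "v \<in> ?V"
      then obtain a where "v = (\<Sum>P\<in>A. cpoly_scale (a P) (?L P))" by blast
      then have "cpoly_scale c v = (\<Sum>P\<in>A. cpoly_scale (c * a P) (?L P))"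
        by (simp add: cpoly.scale_sum_right)
      then show "cpoly_scale c v \<in> ?V" by (intro CollectI exI[of _ "\<lambda>P. c * a P"])
    qed
    moreover have "\<Union> (veronese d ` A) \<subseteq> ?V"
    proof
      fix x assume "x \<in> \<Union> (veronese d ` A)"
      then obtain P where P: "P \<in> A" "x \<in> veronese d P" by blast
      with assms(2) obtain k where k: "x = cpoly_scale k (?L P)"
        using veronese_rep[of P d] by (auto simp: cpoly.span_singleton)
      have "(\<Sum>Q\<in>A. cpoly_scale (if Q = P then k else 0) (?L Q))
          = (\<Sum>Q\<in>A. if Q = P then cpoly_scale k (?L P) else 0)"
        by (intro sum.cong refl) simp
      also have "\<dots> = x" using P(1) assms(1) k by simp
      finally show "x \<in> ?V" by (intro CollectI exI[of _ "\<lambda>Q. if Q = P then k else 0"]) (rule sym)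
    qed
    ultimately show "cpoly.span (\<Union> (veronese d ` A)) \<subseteq> ?V"
      by (intro cpoly.span_minimal)
    show "?V \<subseteq> cpoly.span (\<Union> (veronese d ` A))"
    proof
      fix v assume "v \<in> ?V"
      then obtain a where v: "v = (\<Sum>P\<in>A. cpoly_scale (a P) (?L P))" by blast
      show "v \<in> cpoly.span (\<Union> (veronese d ` A))"
        unfolding v
      proof (intro cpoly.span_sum cpoly.span_scale cpoly.span_base)
        fix P assume P: "P \<in> A"
        then have "?L P \<in> veronese d P"
          using assms(2) veronese_rep[of P d] by (auto intro: cpoly.span_base)
        with P show "?L P \<in> \<Union> (veronese d ` A)" by blast
      qed
    qed
  qed
  then show ?thesis
    unfolding cpoly.proj_span_def cpoly.proj_space_def by auto
qed

lemma separated_of_veronese_independent: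
  fixes \<zeta> :: "'n::finite \<Rightarrow> complex poly poly" and S :: "(complex ^ 'n) set set"
  assumes S: "S \<subseteq> vec.proj_space UNIV"
    and \<zeta>: "\<And>i. \<zeta> i \<in> upto_degree 1"
    and chart: "\<And>P i. P \<in> S \<Longrightarrow> rep P $ i = h P * eval2 (\<zeta> i) (X P) (Y P)"
    and h: "\<And>P. P \<in> S \<Longrightarrow> h P \<noteq> 0"
    and ind: "cpoly.proj_independent (veronese (Suc d) ` S)"
  shows "separated (Suc d) X Y S"
proof (rule separatedI)
  fix P assume P: "P \<in> S"
  let ?L = "\<lambda>P. linear_form (rep P) ^ Suc d"
  have L: "?L Q \<in> veronese (Suc d) Q" if "Q \<in> S" for Q
    using veronese_rep[of Q "Suc d"] that S by (auto intro: cpoly.span_base)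
  obtain \<phi> where \<phi>: "linear_functional cpoly_scale \<phi>"
      "\<And>x. x \<in> veronese (Suc d) P \<Longrightarrow> x \<noteq> 0 \<Longrightarrow> \<phi> x \<noteq> 0"
      "\<And>q x. q \<in> veronese (Suc d) ` S - {veronese (Suc d) P} \<Longrightarrow> x \<in> q \<Longrightarrow> \<phi> x = 0"
    using proj_independent_dual[OF cpoly.vector_space_axioms ind imageI[OF P]] by metis
  have "\<exists>p\<in>upto_degree (Suc d). \<forall>a h x y. (\<forall>i. a $ i = h * eval2 (\<zeta> i) x y) \<longrightarrow>
      \<phi> (linear_form a ^ Suc d) = h ^ Suc d * eval2 p x y"
    by (rule polynomial_of_functional[OF \<phi>(1)]) (rule \<zeta>)
  then obtain p where p: "p \<in> upto_degree (Suc d)"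
      "\<forall>a h x y. (\<forall>i. a $ i = h * eval2 (\<zeta> i) x y) \<longrightarrow>
        \<phi> (linear_form a ^ Suc d) = h ^ Suc d * eval2 p x y"
    by (elim bexE)
  have val: "\<phi> (?L Q) = h Q ^ Suc d * eval2 p (X Q) (Y Q)" if "Q \<in> S" for Q
    using p(2) chart[OF that] by blast
  have "?L P \<noteq> 0"
    using rep(1)[of P] P S by (intro linear_form_power_nonzero) blast
  then have "eval2 p (X P) (Y P) \<noteq> 0"
    using \<phi>(2)[OF L[OF P]] val[OF P] by auto
  moreover have "eval2 p (X Q) (Y Q) = 0" if Q: "Q \<in> S - {P}" for Q
  proof -
    have "veronese (Suc d) Q \<noteq> veronese (Suc d) P"
    proof
      assume eq: "veronese (Suc d) Q = veronese (Suc d) P"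
      have "P \<in> vec.proj_space UNIV" "Q \<in> vec.proj_space UNIV" using P Q S by blast+
      then have "Q = P"
        using veronese_inject[of d "rep Q" "rep P"] eq by (simp add: rep)
      with Q show False by blast
    qed
    then have "\<phi> (?L Q) = 0" using \<phi>(3)[of "veronese (Suc d) Q"] L[of Q] Q by blast
    then show ?thesis using val[of Q] h[of Q] Q by auto
  qed
  ultimately show "\<exists>p\<in>upto_degree (Suc d). eval2 p (X P) (Y P) \<noteq> 0 \<and> (\<forall>Q\<in>S - {P}. eval2 p (X Q) (Y Q) = 0)"
    using p(1) by blast
qed

lemma separated_of_independent:
  fixes \<zeta> :: "'n::finite \<Rightarrow> complex poly poly" and S :: "(complex ^ 'n) set set"
  assumes S: "S \<subseteq> vec.proj_space UNIV"
    and \<zeta>: "\<And>i. \<zeta> i \<in> upto_degree 1"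
    and chart: "\<And>P i. P \<in> S \<Longrightarrow> rep P $ i = h P * eval2 (\<zeta> i) (X P) (Y P)"
    and h: "\<And>P. P \<in> S \<Longrightarrow> h P \<noteq> 0"
    and ind: "vec.proj_independent S"
  shows "separated 1 X Y S"
proof (rule separatedI)
  fix P assume P: "P \<in> S"
  have L: "rep Q \<in> Q" if "Q \<in> S" for Q
    using rep(2)[of Q] that S by (metis vec.span_base singletonI subsetD)
  obtain \<phi> where \<phi>: "linear_functional (*s) \<phi>" "\<And>x. x \<in> P \<Longrightarrow> x \<noteq> 0 \<Longrightarrow> \<phi> x \<noteq> 0"
      "\<And>q x. q \<in> S - {P} \<Longrightarrow> x \<in> q \<Longrightarrow> \<phi> x = 0"
    using proj_independent_dual[OF vec.vector_space_axioms ind P] by metis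
  define p where "p = (\<Sum>i\<in>UNIV. smult [:\<phi> (axis i 1):] (\<zeta> i))"
  have "p \<in> upto_degree 1"
    unfolding p_def by (intro upto_degree_linear_combination \<zeta>)
  have val: "\<phi> (rep Q) = h Q * eval2 p (X Q) (Y Q)" if "Q \<in> S" for Q
  proof -
    have "\<phi> (rep Q) = \<phi> (\<Sum>i\<in>UNIV. (rep Q $ i) *s axis i 1)" by (simp only: basis_expansion)
    also have "\<dots> = (\<Sum>i\<in>UNIV. rep Q $ i * \<phi> (axis i 1))"
      by (rule linear_functional_scaled_sum[OF \<phi>(1)])
    also have "\<dots> = h Q * eval2 p (X Q) (Y Q)"
      unfolding p_def eval2_sum sum_distrib_left
      by (intro sum.cong refl) (simp add: chart[OF that])
    finally show ?thesis .
  qed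
  have "eval2 p (X P) (Y P) \<noteq> 0"
    using \<phi>(2)[OF L[OF P]] val[OF P] rep(1)[of P] P S by auto
  moreover have "eval2 p (X Q) (Y Q) = 0" if Q: "Q \<in> S - {P}" for Q
    using \<phi>(3)[OF Q L[of Q]] val[of Q] h[of Q] Q by auto
  ultimately show "\<exists>p\<in>upto_degree 1. eval2 p (X P) (Y P) \<noteq> 0 \<and> (\<forall>Q\<in>S - {P}. eval2 p (X Q) (Y Q) = 0)"
    using \<open>p \<in> upto_degree 1\<close> by blast
qed

text \<open>The line at infinity is taken from the family of lines with coefficients \<open>(t, t\<^sup>2, 1)\<close>. For a fixed
  point the value of that form is a nonzero polynomial in \<open>t\<close>, so all but finitely many \<open>t\<close> avoid
  \<open>Z\<close>. The coefficient 1 lets the third coordinate be recovered from \<open>X\<close>, \<open>Y\<close> and \<open>h\<close>, which gives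
  \<open>\<zeta> 3 = 1 - t x - t\<^sup>2 y\<close>.\<close>

lemma exists_affine_chart:
  fixes Z :: "(complex ^ 3) set set"
  assumes Z: "finite Z" "Z \<subseteq> vec.proj_space UNIV"
  obtains w :: "complex ^ 3" and h X Y and \<zeta> :: "3 \<Rightarrow> complex poly poly" where
    "\<And>P. P \<in> Z \<Longrightarrow> h P \<noteq> 0" "\<And>P. h P = (\<Sum>i\<in>UNIV. w $ i * rep P $ i)"
    "\<And>i. \<zeta> i \<in> upto_degree 1"
    "\<And>P. P \<in> Z \<Longrightarrow> rep P $ 1 = h P * X P" "\<And>P. P \<in> Z \<Longrightarrow> rep P $ 2 = h P * Y P"
    "\<And>P i. P \<in> Z \<Longrightarrow> rep P $ i = h P * eval2 (\<zeta> i) (X P) (Y P)"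
proof -
  define b where "b P = [:rep P $ 3, rep P $ 1, rep P $ 2:]" for P :: "(complex ^ 3) set"
  have "b P \<noteq> 0" if "P \<in> Z" for P
    using rep(1)[of P] that Z(2) by (auto simp: b_def vec_eq_iff forall_3)
  then have "finite (\<Union>P\<in>Z. {t. poly (b P) t = 0})"
    using Z(1) by (simp add: poly_roots_finite)
  then obtain t where t: "t \<notin> (\<Union>P\<in>Z. {t. poly (b P) t = 0})"
    using ex_new_if_finite[OF infinite_UNIV_char_0] by blast
  define w :: "complex ^ 3" where "w = vector [t, t ^ 2, 1]"
  define h where "h P = (\<Sum>i\<in>UNIV. w $ i * rep P $ i)" for P
  define X Y where "X P = rep P $ 1 / h P" and "Y P = rep P $ 2 / h P" for P
  define \<zeta> :: "3 \<Rightarrow> complex poly poly" where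
    "\<zeta> i = (if i = 1 then [:[:0, 1:], [:0:]:] else if i = 2 then [:[:0, 0:], [:1:]:] else [:[:1, -t:], [:-(t ^ 2):]:])" for i
  have hP: "h P = t * rep P $ 1 + t ^ 2 * rep P $ 2 + rep P $ 3" for P
    by (simp add: h_def w_def sum_3)
  have h: "h P \<noteq> 0" if "P \<in> Z" for P
  proof -
    have "h P = poly (b P) t" by (simp add: hP b_def power2_eq_square algebra_simps)
    with t that show ?thesis by simp
  qed
  show ?thesis
  proof (rule that[where w = w and h = h and X = X and Y = Y and \<zeta> = \<zeta>])
    show "\<zeta> i \<in> upto_degree 1" for i
      unfolding \<zeta>_def
      by (rule if_split[THEN iffD2], intro conjI impI, rule upto_degree_linear,
        rule if_split[THEN iffD2], intro conjI impI; rule upto_degree_linear)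
    show "rep P $ i = h P * eval2 (\<zeta> i) (X P) (Y P)" if "P \<in> Z" for P i
    proof -
      have XY: "h P * X P = rep P $ 1" "h P * Y P = rep P $ 2" using h[OF that] by (simp_all add: X_def Y_def)
      consider "i = 1" | "i = 2" | "i = 3" using exhaust_3 by blast
      then show ?thesis
      proof cases
        case 3
        have "h P * eval2 (\<zeta> i) (X P) (Y P) = h P - t * (h P * X P) - t ^ 2 * (h P * Y P)"
          using 3 by (simp add: \<zeta>_def algebra_simps)
        then show ?thesis unfolding XY by (simp add: 3 hP)
      qed (use XY in \<open>simp_all add: \<zeta>_def\<close>)
    qed
  qed (use h in \<open>simp_all add: X_def Y_def h_def[symmetric]\<close>)
qed


section \<open>Identifiability of the septic\<close>

text \<open>The affine result applied to the two decompositions. Passing to the chart multiplies the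
  coefficient of \<open>P\<close> by the nonzero factor \<open>h P ^ 7\<close>.\<close>

lemma septic_decomposition_contains:
  fixes T :: "3 cpoly set" and A B :: "(complex ^ 3) set set"
  assumes A: "minimal_decomposition 7 T A" "card A = 11"
    and k1: "vec.kruskal_rank A = 3" and k3: "cpoly.kruskal_rank (veronese 3 ` A) = 10"
    and B: "decomposition 7 T B" "card B \<le> 11"
  shows "A \<subseteq> B"
proof -
  have dA: "finite A" "A \<subseteq> vec.proj_space UNIV" "T \<in> cpoly.proj_span (veronese 7 ` A)"
    and min: "\<And>A'. A' \<subset> A \<Longrightarrow> T \<notin> cpoly.proj_span (veronese 7 ` A')"
    using A(1) by (auto simp: minimal_decomposition_def decomposition_def)
  have dB: "finite B" "B \<subseteq> vec.proj_space UNIV" "T \<in> cpoly.proj_span (veronese 7 ` B)"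
    using B(1) by (auto simp: decomposition_def)
  let ?L = "\<lambda>P. linear_form (rep P) ^ 7"
  obtain v a where v: "v \<noteq> 0" "T = cpoly.span {v}" "v = (\<Sum>P\<in>A. cpoly_scale (a P) (?L P))"
    using dA(3) unfolding decomposition_iff_sum[OF dA(1,2)] by blast
  obtain u b where u: "u \<noteq> 0" "T = cpoly.span {u}" "u = (\<Sum>P\<in>B. cpoly_scale (b P) (?L P))"
    using dB(3) unfolding decomposition_iff_sum[OF dB(1,2)] by blast
  have "v \<in> cpoly.span {u}" using u(2) v(2) cpoly.span_base[of v "{v}"] by simp
  then obtain k where k: "v = cpoly_scale k u" unfolding cpoly.span_singleton by blast
  have a: "a P \<noteq> 0" if P: "P \<in> A" for P
  proof
    assume "a P = 0"
    then have "v = (\<Sum>Q\<in>A - {P}. cpoly_scale (a Q) (?L Q))"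
      using v(3) dA(1) P by (simp add: sum.remove)
    moreover have "finite (A - {P})" "A - {P} \<subseteq> vec.proj_space UNIV" using dA by auto
    ultimately have "T \<in> cpoly.proj_span (veronese 7 ` (A - {P}))"
      using v(1,2) by (subst decomposition_iff_sum) auto
    with min[of "A - {P}"] P show False by blast
  qed
  have Z: "finite (A \<union> B)" "A \<union> B \<subseteq> vec.proj_space UNIV" using dA(1,2) dB(1,2) by auto
  show "A \<subseteq> B"
  proof (rule exists_affine_chart[OF Z])
    fix w :: "complex ^ 3" and h X Y and \<zeta> :: "3 \<Rightarrow> complex poly poly"
    assume h: "\<And>P. P \<in> A \<union> B \<Longrightarrow> h P \<noteq> 0" and w: "\<And>P. h P = (\<Sum>i\<in>UNIV. w $ i * rep P $ i)"
      and \<zeta>: "\<And>i. \<zeta> i \<in> upto_degree 1"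
      and XY: "\<And>P. P \<in> A \<union> B \<Longrightarrow> rep P $ 1 = h P * X P" "\<And>P. P \<in> A \<union> B \<Longrightarrow> rep P $ 2 = h P * Y P"
      and chart: "\<And>P i. P \<in> A \<union> B \<Longrightarrow> rep P $ i = h P * eval2 (\<zeta> i) (X P) (Y P)"
  show "A \<subseteq> B"
  proof (rule uniqueness_affine[of A B X Y "\<lambda>P. a P * h P ^ 7" "\<lambda>P. k * b P * h P ^ 7"])
    show "inj_on (\<lambda>P. (X P, Y P)) (A \<union> B)"
    proof (rule inj_onI)
      fix P Q assume PQ: "P \<in> A \<union> B" "Q \<in> A \<union> B" "(X P, Y P) = (X Q, Y Q)"
      have "rep P = (h P / h Q) *s rep Q"
        unfolding vec_eq_iff using chart[OF PQ(1)] chart[OF PQ(2)] h[OF PQ(2)] PQ(3) by simp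
      then have "vec.span {rep P} = vec.span {rep Q}"
        by (rule span_singleton_scale) (use h PQ in simp)
      moreover have "P \<in> vec.proj_space UNIV" "Q \<in> vec.proj_space UNIV" using PQ dA dB by blast+
      ultimately show "P = Q" by (simp add: rep)
    qed
    show "separated 1 X Y S" if S: "S \<subseteq> A" "card S = 3" for S
    proof (rule separated_of_independent[where \<zeta> = \<zeta> and h = h])
      show "vec.proj_independent S"
        using vec.kruskal_rank_independent[OF dA(1) k1] S by simp
      show "S \<subseteq> vec.proj_space UNIV" using S dA by blast
    qed (use S h chart \<zeta> in blast)+
    show "separated 3 X Y S" if S: "S \<subseteq> A" "card S = 10" for S
    proof -
      have "separated (Suc 2) X Y S"
      proof (rule separated_of_veronese_independent[where \<zeta> = \<zeta> and h = h])
        have "card (veronese 3 ` S) \<le> 10"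
          using S dA(1) card_image_le finite_subset by metis
        then have "cpoly.proj_independent (veronese 3 ` S)"
          using cpoly.kruskal_rank_independent[OF _ k3] dA(1) S(1) by blast
        then show "cpoly.proj_independent (veronese (Suc 2) ` S)" by simp
        show "S \<subseteq> vec.proj_space UNIV" using S dA by blast
      qed (use S h chart \<zeta> in blast)+
      then show ?thesis by simp
    qed
    show "(\<Sum>P\<in>A. a P * h P ^ 7 * eval2 g (X P) (Y P)) = (\<Sum>P\<in>B. k * b P * h P ^ 7 * eval2 g (X P) (Y P))"
      if g: "g \<in> upto_degree 7" for g
    proof (rule functional_of_polynomial[OF g, of w])
      fix \<phi> assume \<phi>: "linear_functional cpoly_scale \<phi>"
        "\<And>a h x y. a $ 1 = h * x \<Longrightarrow> a $ 2 = h * y \<Longrightarrow> h = (\<Sum>i\<in>UNIV. w $ i * a $ i) \<Longrightarrow>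
          \<phi> (linear_form (a :: complex ^ 3) ^ 7) = h ^ 7 * eval2 g x y"
      have L: "\<phi> (?L P) = h P ^ 7 * eval2 g (X P) (Y P)" if "P \<in> A \<union> B" for P
        using \<phi>(2)[OF XY(1)[OF that] XY(2)[OF that] w] .
      have "\<phi> v = (\<Sum>P\<in>A. a P * \<phi> (?L P))"
        unfolding v(3) by (rule linear_functional_scaled_sum[OF \<phi>(1)])
      moreover have "\<phi> v = k * (\<Sum>P\<in>B. b P * \<phi> (?L P))"
        using linear_functional_scaled_sum[OF \<phi>(1), of b ?L B] \<phi>(1) unfolding k u(3)[symmetric]
        by (simp add: linear_functional_def)
      ultimately have "(\<Sum>P\<in>A. a P * \<phi> (?L P)) = (\<Sum>P\<in>B. k * (b P * \<phi> (?L P)))"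
        by (simp add: sum_distrib_left)
      then show ?thesis using L by (simp add: mult.assoc)
    qed
    show "a P * h P ^ 7 \<noteq> 0" if "P \<in> A" for P using a[OF that] h[of P] that by simp
  qed (use A(2) B(2) dB(1) in simp_all)
  qed
qed

theorem theorem5p1:
  fixes T :: "3 cpoly set" and A :: "(complex ^ 3) set set"
  assumes "T \<in> cpoly.proj_space (forms 7)"
    and "minimal_decomposition 7 T A"
    and "card A = 11"
    and "vec.kruskal_rank A = 3"
    and "cpoly.kruskal_rank (veronese 3 ` A) = 10"
  shows "waring_rank 7 T = 11 \<and> identifiable 7 T
    \<and> (\<forall>B. decomposition 7 T B \<and> card B = 11 \<longrightarrow> B = A)"
proof -
  have A: "decomposition 7 T A" using assms(2) by (simp add: minimal_decomposition_def)
  have unique: "B = A" if B: "decomposition 7 T B" "card B \<le> 11" for B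
  proof -
    have "A \<subseteq> B" using assms(2-5) B by (rule septic_decomposition_contains)
    moreover have "finite B" using B(1) by (simp add: decomposition_def)
    ultimately show ?thesis using B(2) assms(3) by (metis card_seteq)
  qed
  have rank: "waring_rank 7 T = 11"
    unfolding waring_rank_def
  proof (rule Least_equality)
    show "\<exists>A. decomposition 7 T A \<and> card A = 11" using A assms(3) by blast
    show "11 \<le> r" if r: "\<exists>B. decomposition 7 T B \<and> card B = r" for r
    proof (rule ccontr)
      assume "\<not> 11 \<le> r"
      with r unique assms(3) show False by (metis nat_le_linear)
    qed
  qed
  moreover have "identifiable 7 T"
    unfolding identifiable_def rank using A assms(3) unique by (metis order_refl)
  ultimately show ?thesis using unique by simp
qed

end
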